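(* Let $\mathcal{A}$ be a sign pattern of order $n$. Suppose $A=[a_{ij}]\in Q(\mathcal{A})$ is a matrix with refined inertia $(0,0,c_1,c_2)$ for some $c_1\geq 2$, and $A$ allows a full-rank Jacobian. Let $j,k\in\{1,\dots,n\}$ with $j\neq k$ and suppose that $a_{jk}$ is non-Jacobian for some choice of $X_A$. Let $b$ be a nonzero real number. If $a_{kv}\neq 0$ and $\det A(j,v)\neq 0$ for some $v\in\{1,\dots,n\}$, then the matrix of order $n+1$ $$B=\left[\begin{array}{c|c} A-bP_{jk} & \mathbf{e}_j\\ \hline b\, r_k(A-bP_{jk}) & 0\end{array}\right]$$ has refined inertia $(0,0,c_1+1,c_2)$, $B$ allows a full-rank Jacobian, and every superpattern of $\mathcal{B}=\operatorname{sgn}(B)$ is inertially arbitrary.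
   Context: All matrices are real. A sign pattern of order $n$ is an $n\times n$ matrix $\mathcal{A}=[\alpha_{ij}]$ with entries in $\{0,+,-\}$. $Q(\mathcal{A})$ is the set of real $n\times n$ matrices $A=[a_{ij}]$ with $a_{ij}=0$ if $\alpha_{ij}=0$, $a_{ij}>0$ if $\alpha_{ij}=+$, and $a_{ij}<0$ if $\alpha_{ij}=-$. If $A\in Q(\mathcal{A})$, write $\operatorname{sgn}(A)=\mathcal{A}$. A pattern $\mathcal{B}=[\beta_{ij}]$ is a superpattern of $\mathcal{A}=[\alpha_{ij}]$ (of the same order) if $\alpha_{ij}\neq 0$ implies $\beta_{ij}=\alpha_{ij}$. The inertia of a matrix $A$ is the triple $i(A)=(a,b,c)$, where $a$, $b$, $c$ are the numbers of eigenvalues of $A$ (counted with algebraic multiplicity) with positive, negative and zero real part, respectively. The refined inertia of $A$ is the $4$-tuple $(a,b,c_1,c_2)$, where $c_1$ is the algebraic multiplicity of zero as an eigenvalue of $A$ and $c_1+c_2=c$ (so $c_2$ is the number of nonzero purely imaginary eigenvalues). A sign pattern $\mathcal{A}$ of order $n$ is inertially arbitrary if for every triple of nonnegative integers $(a,b,c)$ with $a+b+c=n$ there is a matrix $A\in Q(\mathcal{A})$ with $i(A)=(a,b,c)$. Full-rank Jacobian: let $A$ be a matrix of order $n$. Choose $m\ge n$ nonzero entries $a_{i_1j_1},\dots,a_{i_mj_m}$ of $A$ and let $X=X_A(x_1,\dots,x_m)$ be obtained from $A$ by replacing $a_{i_kj_k}$ with a variable $x_k$ for $k=1,\dots,m$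 (all other entries are kept fixed). Write the characteristic polynomial $\det(zI-X)=z^n+f_1z^{n-1}+\cdots+f_{n-1}z+f_n$ with $f_i=f_i(x_1,\dots,x_m)$, and let $J_{X=A}$ be the $n\times m$ matrix with $(i,j)$ entry $\partial f_i/\partial x_j$ evaluated at $(x_1,\dots,x_m)=(a_{i_1j_1},\dots,a_{i_mj_m})$. A matrix $A$ with refined inertia $(0,0,c_1,c_2)$ allows a full-rank Jacobian if, for some such choice of entries, $J_{X=A}$ has rank $n$. When $J_{X=A}$ has rank $n$ for a given choice $X_A$, a nonzero entry of $A$ is called Jacobian in $X_A$ if it is replaced by a variable in $X_A$; otherwise the entry is non-Jacobian in $X_A$ (a non-Jacobian entry may be zero). Thus "$a_{jk}$ is non-Jacobian for some choice of $X_A$" means that there is a choice of $X_A$ with $J_{X=A}$ of rank $n$ in which position $(j,k)$ is not replaced by a variable. Notation: $r_k(M)$ is the $k$th row of $M$; $P_{jk}$ is the $n\times n$ matrix with a $1$ in entry $(j,k)$ and zeros elsewhere; $\mathbf{e}_j\in\mathbb{R}^n$ is the $j$th standard unit column vector; $A(u,v)$ is the matrix obtained from $A$ by deleting row $u$ and column $v$. *)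

theory Defs
  imports
    "HOL-Analysis.Derivative"
    "Jordan_Normal_Form.Char_Poly"
    "Jordan_Normal_Form.DL_Rank"
begin

text \<open>Rows and columns of matrices are indexed from 0, so the indices \<open>{1,\<dots>,n}\<close> become \<open>{0..<n}\<close>.\<close>

datatype sign = Zero | Plus | Minus

definition sign_of :: "real \<Rightarrow> sign" where
  "sign_of x = (if x = 0 then Zero else if x > 0 then Plus else Minus)"

definition sgn_mat :: "real mat \<Rightarrow> sign mat" where
  "sgn_mat A = map_mat sign_of A"

definition qual_class :: "sign mat \<Rightarrow> real mat set" where
  "qual_class P = {A. dim_row A = dim_row P \<and> dim_col A = dim_col P \<and>
     (\<forall>r < dim_row P. \<forall>s < dim_col P.
        (P $$ (r, s) = Zero \<longrightarrow> A $$ (r, s) = 0) \<and>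
        (P $$ (r, s) = Plus \<longrightarrow> A $$ (r, s) > 0) \<and>
        (P $$ (r, s) = Minus \<longrightarrow> A $$ (r, s) < 0))}"

definition superpattern :: "sign mat \<Rightarrow> sign mat \<Rightarrow> bool" where
  "superpattern S P \<longleftrightarrow> dim_row S = dim_row P \<and> dim_col S = dim_col P \<and>
     (\<forall>r < dim_row P. \<forall>s < dim_col P. P $$ (r, s) \<noteq> Zero \<longrightarrow> S $$ (r, s) = P $$ (r, s))"

definition num_eigenvalues :: "real mat \<Rightarrow> (complex \<Rightarrow> bool) \<Rightarrow> nat" where
  "num_eigenvalues A R =
     (let C = map_mat complex_of_real A
      in \<Sum>z \<in> {z. eigenvalue C z \<and> R z}. Polynomial.order z (char_poly C))"

definition inertia :: "real mat \<Rightarrow> nat \<times> nat \<times> nat" where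
  "inertia A = (num_eigenvalues A (\<lambda>z. Re z > 0),
                num_eigenvalues A (\<lambda>z. Re z < 0),
                num_eigenvalues A (\<lambda>z. Re z = 0))"

definition refined_inertia :: "real mat \<Rightarrow> nat \<times> nat \<times> nat \<times> nat" where
  "refined_inertia A = (num_eigenvalues A (\<lambda>z. Re z > 0),
                        num_eigenvalues A (\<lambda>z. Re z < 0),
                        num_eigenvalues A (\<lambda>z. z = 0),
                        num_eigenvalues A (\<lambda>z. Re z = 0 \<and> z \<noteq> 0))"

definition inertially_arbitrary :: "sign mat \<Rightarrow> bool" where
  "inertially_arbitrary P \<longleftrightarrow>
     (\<forall>a b c. a + b + c = dim_row P \<longrightarrow> (\<exists>A \<in> qual_class P. inertia A = (a, b, c)))"

text \<open>A choice of entries is a list \<open>ps\<close> of distinct positions; the value replacing the entry at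
  \<open>ps ! l\<close> is \<open>xs ! l\<close>.\<close>

definition X_mat :: "real mat \<Rightarrow> (nat \<times> nat) list \<Rightarrow> real list \<Rightarrow> real mat" where
  "X_mat A ps xs = mat (dim_row A) (dim_col A)
     (\<lambda>p. case map_of (zip ps xs) p of None \<Rightarrow> A $$ p | Some x \<Rightarrow> x)"

definition f_coeff :: "real mat \<Rightarrow> (nat \<times> nat) list \<Rightarrow> nat \<Rightarrow> real list \<Rightarrow> real" where
  "f_coeff A ps i xs = coeff (char_poly (X_mat A ps xs)) (dim_row A - i)"

text \<open>Row \<open>i\<close> of the Jacobian holds the partial derivatives of the coefficient of \<open>z\<close> to the
  power \<open>n - (i + 1)\<close>, because of the index shift.\<close>

definition jacobian_mat :: "real mat \<Rightarrow> (nat \<times> nat) list \<Rightarrow> real mat" where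
  "jacobian_mat A ps =
     (let xs = map (\<lambda>p. A $$ p) ps
      in mat (dim_row A) (length ps)
           (\<lambda>(i, l). deriv (\<lambda>t. f_coeff A ps (i + 1) (xs[l := t])) (xs ! l)))"

definition full_rank_choice :: "real mat \<Rightarrow> (nat \<times> nat) list \<Rightarrow> bool" where
  "full_rank_choice A ps \<longleftrightarrow>
     distinct ps \<and> length ps \<ge> dim_row A \<and>
     (\<forall>(r, s) \<in> set ps. r < dim_row A \<and> s < dim_col A \<and> A $$ (r, s) \<noteq> 0) \<and>
     vec_space.rank (dim_row A) (jacobian_mat A ps) = dim_row A"

definition allows_full_rank_jacobian :: "real mat \<Rightarrow> bool" where
  "allows_full_rank_jacobian A \<longleftrightarrow> (\<exists>ps. full_rank_choice A ps)"

definition non_jacobian_for_some_choice :: "real mat \<Rightarrow> nat \<Rightarrow> nat \<Rightarrow> bool" where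
  "non_jacobian_for_some_choice A j k \<longleftrightarrow> (\<exists>ps. full_rank_choice A ps \<and> (j, k) \<notin> set ps)"

definition P_mat :: "nat \<Rightarrow> nat \<Rightarrow> nat \<Rightarrow> real mat" where
  "P_mat n j k = mat n n (\<lambda>(r, s). if r = j \<and> s = k then 1 else 0)"

definition bordered_mat :: "nat \<Rightarrow> real mat \<Rightarrow> real \<Rightarrow> nat \<Rightarrow> nat \<Rightarrow> real mat" where
  "bordered_mat n A b j k =
     (let A' = A - b \<cdot>\<^sub>m P_mat n j k
      in four_block_mat A' (mat_of_cols n [unit_vec n j])
           (mat_of_rows n [b \<cdot>\<^sub>v row A' k]) (0\<^sub>m 1 1))"

end

theory Submission
  imports Defs "HOL-Analysis.Function_Topology"
begin

text \<open>
  The theorem rests on two facts. The first is that a matrix with refined inertia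
  \<open>(0, 0, c1, c2)\<close>, \<open>c1 \<ge> 2\<close>, that allows a full-rank Jacobian forces every superpattern of its sign
  pattern to be inertially arbitrary (\<open>superpatterns_inertially_arbitrary\<close>). The second is that
  bordering carries both hypotheses from \<open>A\<close> to \<open>B\<close>, with \<open>c1\<close> increased by one.

  First fact. The coefficients of the characteristic polynomial are polynomials in the entries, and
  full rank says that their differential is onto already along the chosen nonzero entries. If the
  zero entries of \<open>A\<close> are moved to tiny values with the signs prescribed by the superpattern, an
  inverse function argument adjusts the chosen entries slightly so that the characteristic polynomial
  becomes any prescribed monic polynomial close to the original one
  (\<open>char_coeffs_locally_surjective_on_superpattern\<close>). The dimension varies with the matrix, so the
  argument is carried out for functions on index sets: the coefficients are expanded as
  \<open>g x - g y = (\<Sum>i. q i (x, y) * (x i - y i))\<close> with continuous \<open>q i\<close>, and Newton's iteration is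
  replaced by minimizing a displacement over a compact box. It then suffices to
  find polynomials of every inertia near the characteristic polynomial of \<open>A\<close>, which is
  \<open>z ^ c1 * (\<Prod>\<beta>. z\<^sup>2 + \<beta>\<^sup>2)\<close>: each factor \<open>z\<close> can be kept or moved to \<open>z - t\<close> or \<open>z + t\<close>, and each
  quadratic factor likewise to \<open>(z - t)\<^sup>2 + \<beta>\<^sup>2\<close> or \<open>(z + t)\<^sup>2 + \<beta>\<^sup>2\<close>. The pairs of conjugate roots can be
  distributed over the three parts of any triple because \<open>c1 \<ge> 2\<close> leaves room for the parities
  (\<open>nearby_polys_of_every_inertia\<close>).

  Second fact. Adding \<open>b\<close> times the last column of \<open>B\<close> to column \<open>k\<close> and subtracting \<open>b\<close> times row
  \<open>k\<close> from the last row is a similarity that turns \<open>B\<close> into \<open>A\<close> bordered by the column \<open>e\<^sub>j\<close> and a zero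
  row. Hence the characteristic polynomial of \<open>B\<close> is \<open>z\<close> times that of \<open>A\<close>. Perturbations of \<open>A\<close> lift
  to perturbations of \<open>B\<close> in its nonzero entries, in such a way that this relation persists; so all
  polynomial directions divisible by \<open>z\<close> are reached. The one missing direction, the constant
  coefficient, is supplied by the entry of \<open>B\<close> in the last row and column \<open>v\<close>: its cofactor is
  \<open>\<plusminus> det A(j, v)\<close>, which is nonzero (\<open>bordered_full_rank_jacobian\<close>).
\<close>

unbundle no vec_syntax

section \<open>Difference quotients of polynomial functions\<close>

text \<open>
  Pairs of points tending to \<open>(a, a)\<close> in the coordinates from \<open>I\<close>. Only finitely many coordinates
  matter, so one positive number describes a neighbourhood, and the other coordinates stay free.
\<close>
definition box_pairs :: "'i set \<Rightarrow> ('i \<Rightarrow> real) \<Rightarrow> (('i \<Rightarrow> real) \<times> ('i \<Rightarrow> real)) filter" where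
  "box_pairs I a = (INF d\<in>{0<..}. principal {(x, y). \<forall>i\<in>I. \<bar>x i - a i\<bar> < d \<and> \<bar>y i - a i\<bar> < d})"

lemma eventually_box_pairs:
  "eventually P (box_pairs I a) \<longleftrightarrow>
     (\<exists>d>0. \<forall>x y. (\<forall>i\<in>I. \<bar>x i - a i\<bar> < d \<and> \<bar>y i - a i\<bar> < d) \<longrightarrow> P (x, y))"
  unfolding box_pairs_def
proof (subst eventually_INF_base, goal_cases)
  case (2 d e)
  then show ?case by (intro bexI[of _ "min d e"]) auto
qed (auto simp: eventually_principal)

lemma tendsto_box_pairs_coordinate:
  assumes "i \<in> I"
  shows "((\<lambda>z. fst z i) \<longlongrightarrow> a i) (box_pairs I a)" "((\<lambda>z. snd z i) \<longlongrightarrow> a i) (box_pairs I a)"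
  using assms by (auto simp: tendsto_iff eventually_box_pairs dist_real_def)

text \<open>
  The factorization of Hadamard's lemma, with the coefficients \<open>q\<close> continuous at \<open>(a, a)\<close>. It is
  preserved by sums and products without any estimate, its values at \<open>(a, a)\<close> are the partial
  derivatives, and it also controls \<open>g x - g y\<close> for two moving points, which a derivative at \<open>a\<close>
  alone does not; the contraction estimate below needs this.
\<close>
definition has_slopes ::
    "'i set \<Rightarrow> ('i \<Rightarrow> real) \<Rightarrow> (('i \<Rightarrow> real) \<Rightarrow> real) \<Rightarrow>
      ('i \<Rightarrow> ('i \<Rightarrow> real) \<times> ('i \<Rightarrow> real) \<Rightarrow> real) \<Rightarrow> bool" where
  "has_slopes I a g q \<longleftrightarrow>
     (\<forall>x y. g x - g y = (\<Sum>i\<in>I. q i (x, y) * (x i - y i))) \<and>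
     (\<forall>i\<in>I. (q i \<longlongrightarrow> q i (a, a)) (box_pairs I a)) \<and>
     ((\<lambda>z. g (fst z)) \<longlongrightarrow> g a) (box_pairs I a) \<and>
     ((\<lambda>z. g (snd z)) \<longlongrightarrow> g a) (box_pairs I a)"

lemma has_slopes_const: "has_slopes I a (\<lambda>x. c) (\<lambda>i z. 0)"
  by (simp add: has_slopes_def)

lemma has_slopes_coordinate:
  assumes "finite I" "p \<in> I"
  shows "has_slopes I a (\<lambda>x. x p) (\<lambda>i z. if i = p then 1 else 0)"
  using assms tendsto_box_pairs_coordinate[of p I a]
  by (auto simp: has_slopes_def if_distrib[of "\<lambda>c. c * _"] sum.delta cong: if_cong)

lemma has_slopes_add:
  assumes "has_slopes I a f q" "has_slopes I a g r"
  shows "has_slopes I a (\<lambda>x. f x + g x) (\<lambda>i z. q i z + r i z)"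
  unfolding has_slopes_def
proof (intro conjI allI ballI)
  fix x y
  have "f x + g x - (f y + g y) = (f x - f y) + (g x - g y)" by simp
  also have "\<dots> = (\<Sum>i\<in>I. q i (x, y) * (x i - y i)) + (\<Sum>i\<in>I. r i (x, y) * (x i - y i))"
    using assms unfolding has_slopes_def by simp
  also have "\<dots> = (\<Sum>i\<in>I. (q i (x, y) + r i (x, y)) * (x i - y i))"
    by (simp add: sum.distrib distrib_right)
  finally show "f x + g x - (f y + g y) = \<dots>" .
qed (use assms in \<open>auto simp: has_slopes_def intro!: tendsto_add\<close>)

text \<open>
  The product rule comes from \<open>f x * g x - f y * g y = (f x - f y) * g x + f y * (g x - g y)\<close>.
\<close>
lemma has_slopes_mult:
  assumes f: "has_slopes I a f q" and g: "has_slopes I a g r"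
  shows "has_slopes I a (\<lambda>x. f x * g x) (\<lambda>i z. q i z * g (fst z) + f (snd z) * r i z)"
  unfolding has_slopes_def
proof (intro conjI allI ballI)
  fix x y
  have "f x * g x - f y * g y = (f x - f y) * g x + f y * (g x - g y)"
    by (simp add: algebra_simps)
  also have "\<dots> = (\<Sum>i\<in>I. q i (x, y) * (x i - y i)) * g x + f y * (\<Sum>i\<in>I. r i (x, y) * (x i - y i))"
    using f g unfolding has_slopes_def by simp
  also have "\<dots> = (\<Sum>i\<in>I. (q i (x, y) * g (fst (x, y)) + f (snd (x, y)) * r i (x, y)) * (x i - y i))"
    by (simp add: sum_distrib_left sum_distrib_right sum.distrib sum_subtractf algebra_simps)
  finally show "f x * g x - f y * g y = \<dots>" .
qed (use f g in \<open>auto simp: has_slopes_def intro!: tendsto_intros\<close>)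

abbreviation sloped_at :: "'i set \<Rightarrow> ('i \<Rightarrow> real) \<Rightarrow> (('i \<Rightarrow> real) \<Rightarrow> real) \<Rightarrow> bool" where
  "sloped_at I a g \<equiv> \<exists>q. has_slopes I a g q"

abbreviation sloped_poly_at :: "'i set \<Rightarrow> ('i \<Rightarrow> real) \<Rightarrow> (('i \<Rightarrow> real) \<Rightarrow> real poly) \<Rightarrow> bool" where
  "sloped_poly_at I a p \<equiv> \<forall>k. sloped_at I a (\<lambda>x. coeff (p x) k)"

lemma sloped_at_sum:
  assumes "\<And>s. s \<in> S \<Longrightarrow> sloped_at I a (f s)"
  shows "sloped_at I a (\<lambda>x. \<Sum>s\<in>S. f s x)"
  using assms
proof (induction S rule: infinite_finite_induct)
  case (insert s S)
  then obtain q r where "has_slopes I a (f s) q" "has_slopes I a (\<lambda>x. \<Sum>s\<in>S. f s x) r"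
    by (meson insertI1 insertI2)
  from has_slopes_add[OF this] insert show ?case by auto
qed (auto intro: has_slopes_const)

lemma sloped_poly_at_mult:
  assumes "sloped_poly_at I a p" "sloped_poly_at I a q"
  shows "sloped_poly_at I a (\<lambda>x. p x * q x)"
proof
  fix k
  have "sloped_at I a (\<lambda>x. coeff (p x) i * coeff (q x) (k - i))" for i
    using assms has_slopes_mult by blast
  then show "sloped_at I a (\<lambda>x. coeff (p x * q x) k)"
    by (simp add: coeff_mult sloped_at_sum)
qed

lemma sloped_poly_at_const: "sloped_poly_at I a (\<lambda>x. c)"
  by (blast intro: has_slopes_const)

lemma sloped_poly_at_sum:
  "(\<And>s. s \<in> S \<Longrightarrow> sloped_poly_at I a (p s)) \<Longrightarrow> sloped_poly_at I a (\<lambda>x. \<Sum>s\<in>S. p s x)"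
  by (simp add: coeff_sum sloped_at_sum)

lemma sloped_poly_at_prod:
  assumes "\<And>s. s \<in> S \<Longrightarrow> sloped_poly_at I a (p s)"
  shows "sloped_poly_at I a (\<lambda>x. \<Prod>s\<in>S. p s x)"
  using assms
proof (induction S rule: infinite_finite_induct)
  case (insert s S)
  then have "sloped_poly_at I a (\<lambda>x. p s x * (\<Prod>s\<in>S. p s x))"
    by (intro sloped_poly_at_mult) auto
  then show ?case using insert by simp
qed (use sloped_poly_at_const[of I a 1] in simp_all)


section \<open>Partial derivatives of the characteristic coefficients\<close>

definition char_coeff :: "nat \<Rightarrow> nat \<Rightarrow> (nat \<times> nat \<Rightarrow> real) \<Rightarrow> real" where
  "char_coeff n i X = coeff (char_poly (mat n n X)) i"

abbreviation positions :: "nat \<Rightarrow> (nat \<times> nat) set" where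
  "positions n \<equiv> {..<n} \<times> {..<n}"

text \<open>The Leibniz expansion makes each coefficient a polynomial in the entries.\<close>
lemma sloped_char_coeff: "sloped_at (positions n) a (char_coeff n i)"
proof -
  let ?I = "positions n"
  let ?e = "\<lambda>X (r, s). (if r = s then [:0, 1:] else 0) + [:- X (r, s):] :: real poly"
  have entry: "sloped_poly_at ?I a (\<lambda>X. ?e X p)" if p: "p \<in> ?I" for p
  proof
    fix k
    obtain r s where [simp]: "p = (r, s)" by (cases p)
    have "has_slopes ?I a (\<lambda>X. coeff (if r = s then [:0, 1:] else 0) k + (if k = 0 then - 1 else 0) * X p)
       (\<lambda>i z. 0 + (0 * fst z p + (if k = 0 then - 1 else 0) * (if i = p then 1 else 0)))"
      by (intro has_slopes_add has_slopes_mult has_slopes_const has_slopes_coordinate) (use p in auto)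
    moreover have "(\<lambda>X. coeff (?e X p) k) =
        (\<lambda>X. coeff (if r = s then [:0, 1:] else 0) k + (if k = 0 then - 1 else 0) * X p)"
      by (auto simp: coeff_pCons split: nat.splits)
    ultimately show "sloped_at ?I a (\<lambda>X. coeff (?e X p) k)" by auto
  qed
  have det: "char_poly (mat n n X) =
      (\<Sum>\<pi> | \<pi> permutes {0..<n}. signof \<pi> * (\<Prod>r = 0..<n. ?e X (r, \<pi> r)))" for X
  proof -
    have "char_poly_matrix (mat n n X) $$ (r, \<pi> r) = ?e X (r, \<pi> r)"
      if "r < n" "\<pi> permutes {0..<n}" for r \<pi>
      using that permutes_in_image[of \<pi> "{0..<n}" r]
      by (auto simp: char_poly_matrix_def)
    then show ?thesis
      unfolding char_poly_def by (subst det_def'[of _ n]) (auto intro!: sum.cong prod.cong)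
  qed
  have "sloped_poly_at ?I a (\<lambda>X. char_poly (mat n n X))"
    unfolding det
    by (intro sloped_poly_at_sum sloped_poly_at_mult sloped_poly_at_prod sloped_poly_at_const entry)
       (auto dest: permutes_in_image)
  then show ?thesis unfolding char_coeff_def by blast
qed

definition char_partial :: "nat \<Rightarrow> (nat \<times> nat \<Rightarrow> real) \<Rightarrow> nat \<Rightarrow> nat \<times> nat \<Rightarrow> real" where
  "char_partial n a i p = deriv (\<lambda>t. char_coeff n i (a(p := t))) (a p)"

text \<open>
  Along the line \<open>a + t * E\<close> the increment is \<open>t * (\<Sum>p. q p (a + t * E, a) * E p)\<close>, which is the
  Caratheodory form of differentiability.
\<close>
lemma has_slopes_directional_derivative:
  assumes "has_slopes I a g q"
  shows "((\<lambda>t. g (\<lambda>p. a p + t * E p)) has_field_derivative (\<Sum>p\<in>I. q p (a, a) * E p)) (at 0)"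
  unfolding CARAT_DERIV
proof (intro exI conjI allI)
  let ?l = "\<lambda>t p. a p + t * E p"
  let ?G = "\<lambda>t. \<Sum>p\<in>I. q p (?l t, a) * E p"
  show "g (?l t) - g (?l 0) = ?G t * (t - 0)" for t
    using assms unfolding has_slopes_def by (simp add: sum_distrib_left sum_distrib_right ac_simps)
  show "?G 0 = (\<Sum>p\<in>I. q p (a, a) * E p)" by simp
  have line: "filterlim (\<lambda>t. (?l t, a)) (box_pairs I a) (at 0)" if "finite I"
    unfolding filterlim_def le_filter_def eventually_filtermap eventually_box_pairs
  proof (intro allI impI, elim exE conjE)
    fix P and d :: real assume d: "d > 0"
      and P: "\<forall>x y. (\<forall>i\<in>I. \<bar>x i - a i\<bar> < d \<and> \<bar>y i - a i\<bar> < d) \<longrightarrow> P (x, y)"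
    have "\<forall>\<^sub>F t in at 0. \<bar>t * E i\<bar> < d" for i
    proof -
      have "((\<lambda>t. \<bar>t * E i\<bar>) \<longlongrightarrow> \<bar>0 * E i\<bar>) (at 0)" by (intro tendsto_intros)
      then show ?thesis using d by (intro order_tendstoD(2)) auto
    qed
    then have "\<forall>\<^sub>F t in at 0. \<forall>i\<in>I. \<bar>t * E i\<bar> < d"
      using that by (simp add: eventually_ball_finite_distrib)
    then show "\<forall>\<^sub>F t in at 0. P (?l t, a)"
      by eventually_elim (use P d in auto)
  qed
  have "(?G \<longlongrightarrow> ?G 0) (at 0)"
  proof (cases "finite I")
    case True
    show ?thesis
      using assms filterlim_compose[OF _ line[OF True], of "q _"]
      by (auto simp: has_slopes_def intro!: tendsto_sum tendsto_mult)
  qed simp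
  then show "isCont ?G 0" by (simp add: isCont_def)
qed

lemma slopes_char_coeff_eq_partial:
  assumes q: "has_slopes (positions n) a (char_coeff n i) q" and p: "p \<in> positions n"
  shows "q p (a, a) = char_partial n a i p"
proof -
  let ?E = "\<lambda>r. if r = p then 1 else 0 :: real"
  have "(\<Sum>r\<in>positions n. q r (a, a) * ?E r) = q p (a, a)"
    using p by (simp add: if_distrib[of "\<lambda>c. _ * c"] sum.delta cong: if_cong)
  with has_slopes_directional_derivative[OF q, of ?E]
  have "((\<lambda>t. char_coeff n i (\<lambda>r. a r + t * ?E r)) has_field_derivative q p (a, a))
      (at (a p + - a p))"
    by simp
  then have "((\<lambda>t. char_coeff n i (\<lambda>r. a r + (t - a p) * ?E r)) has_field_derivative q p (a, a)) (at (a p))"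
    by (subst (asm) DERIV_shift) simp
  moreover have "(\<lambda>r. a r + (t - a p) * ?E r) = a(p := t)" for t by auto
  ultimately show ?thesis
    unfolding char_partial_def by (intro DERIV_imp_deriv[symmetric]) simp
qed

text \<open>
  The partial derivatives in the Jacobian thus determine the derivative in every direction, so that
  they can be computed from directions in which the characteristic polynomial is easy.
\<close>
lemma DERIV_char_coeff_line:
  "((\<lambda>t. char_coeff n i (\<lambda>p. a p + t * E p)) has_field_derivative
     (\<Sum>p\<in>positions n. char_partial n a i p * E p)) (at 0)"
proof -
  obtain q where q: "has_slopes (positions n) a (char_coeff n i) q" using sloped_char_coeff by blast
  from has_slopes_directional_derivative[OF q, of E] show ?thesis
    by (simp add: slopes_char_coeff_eq_partial[OF q] cong: sum.cong)
qed

section \<open>Full rank as surjectivity of the differential\<close>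

text \<open>
  A maximal independent set of columns has as many elements as the rank; if there are \<open>n\<close> of them they
  form a basis of the whole space.
\<close>
lemma (in vec_space) rank_eq_dim_iff_surjective:
  assumes A: "A \<in> carrier_mat n nc"
  shows "rank A = n \<longleftrightarrow> (\<forall>y\<in>carrier_vec n. \<exists>x\<in>carrier_vec nc. A *\<^sub>v x = y)"
proof -
  have cols: "set (cols A) \<subseteq> carrier_vec n" using cols_dim A by blast
  have "rank A = n \<longleftrightarrow> span (set (cols A)) = carrier_vec n"
  proof
    assume rank: "rank A = n"
    obtain U where U: "maximal U (\<lambda>T. T \<subseteq> set (cols A) \<and> lin_indpt T)"
      using maximal_exists_superset[of "set (cols A)" "\<lambda>T. T \<subseteq> set (cols A) \<and> lin_indpt T" "{}"]
      by (auto simp: lin_dep_def)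
    then have sub: "U \<subseteq> set (cols A)" "lin_indpt U" by (auto simp: maximal_def)
    have "card U = n" using rank_card_indpt[OF A U] rank by simp
    then have "basis U"
      using sub cols finite_subset[OF sub(1)] by (intro dim_li_is_basis) (auto simp: dim_is_n)
    then have "carrier_vec n = span U" by (auto simp: basis_def)
    also have "\<dots> \<subseteq> span (set (cols A))" by (rule span_is_monotone[OF sub(1)])
    finally show "span (set (cols A)) = carrier_vec n"
      using span_is_subset2[OF cols] by auto
  next
    assume "span (set (cols A)) = carrier_vec n"
    then have "vs (span (set (cols A))) = V" by (simp add: module_vec_def)
    then show "rank A = n" by (simp add: rank_def dim_is_n)
  qed
  also have "\<dots> \<longleftrightarrow> col_space A = carrier_vec n" by (simp add: col_space_def)
  also have "\<dots> \<longleftrightarrow> (\<forall>y\<in>carrier_vec n. \<exists>x\<in>carrier_vec nc. A *\<^sub>v x = y)"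
    unfolding col_space_eq[OF A] using A by auto
  finally show ?thesis .
qed

text \<open>
  The coordinate-free content of a full-rank Jacobian: perturbing only the positions in \<open>P\<close>, the
  characteristic coefficients can be moved in any direction to first order.
\<close>
definition surjective_along :: "nat \<Rightarrow> (nat \<times> nat \<Rightarrow> real) \<Rightarrow> (nat \<times> nat) set \<Rightarrow> bool" where
  "surjective_along n a P \<longleftrightarrow>
     (\<forall>u. \<exists>E. (\<forall>p. p \<notin> P \<longrightarrow> E p = 0) \<and>
       (\<forall>i<n. (\<Sum>p\<in>positions n. char_partial n a i p * E p) = u i))"

lemma mat_of_entries: "A \<in> carrier_mat n m \<Longrightarrow> mat n m (\<lambda>p. A $$ p) = A"
  by (intro eq_matI) auto

lemma jacobian_mat_index:
  assumes A: "A \<in> carrier_mat n n" and ps: "distinct ps" and i: "i < n" and l: "l < length ps"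
  shows "jacobian_mat A ps $$ (i, l) = char_partial n (\<lambda>p. A $$ p) (n - (i + 1)) (ps ! l)"
proof -
  let ?xs = "map (\<lambda>p. A $$ p) ps"
  have "X_mat A ps (?xs[l := t]) = mat n n ((\<lambda>p. A $$ p)(ps ! l := t))" for t
  proof -
    have "(case map_of (zip ps (?xs[l := t])) p of None \<Rightarrow> A $$ p | Some x \<Rightarrow> x) =
       ((\<lambda>p. A $$ p)(ps ! l := t)) p" for p
    proof (cases "p \<in> set ps")
      case True
      then obtain m where m: "m < length ps" "p = ps ! m" by (auto simp: in_set_conv_nth)
      then have "map_of (zip ps (?xs[l := t])) p = Some (?xs[l := t] ! m)"
        using ps by (simp add: map_of_zip_nth)
      then show ?thesis
        using m l ps by (auto simp: nth_list_update nth_eq_iff_index_eq)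
    next
      case False
      then have "map_of (zip ps (?xs[l := t])) p = None" by simp
      moreover have "p \<noteq> ps ! l" using False l by auto
      ultimately show ?thesis by (simp only: option.case fun_upd_apply if_False)
    qed
    then show ?thesis using A unfolding X_mat_def by (intro eq_matI) auto
  qed
  then show ?thesis
    using A i l by (simp add: jacobian_mat_def char_partial_def f_coeff_def char_coeff_def Let_def)
qed

text \<open>
  The Jacobian lists the coefficients from the top one downwards, so its row \<open>i\<close> belongs to the
  coefficient \<open>n - (i + 1)\<close>; reversing the order of the targets does not affect surjectivity.
\<close>
lemma full_rank_choice_iff_surjective_along:
  assumes A: "A \<in> carrier_mat n n"
  shows "full_rank_choice A ps \<longleftrightarrow>
     distinct ps \<and> (\<forall>p\<in>set ps. p \<in> positions n \<and> A $$ p \<noteq> 0) \<and>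
     surjective_along n (\<lambda>p. A $$ p) (set ps)"
proof -
  interpret vec_space "TYPE(real)" n .
  let ?J = "jacobian_mat A ps" and ?m = "length ps"
  let ?d = "char_partial n (\<lambda>p. A $$ p)"
  have J: "?J \<in> carrier_mat n ?m" using A by (auto simp: jacobian_mat_def Let_def)
  have "(\<forall>y\<in>carrier_vec n. \<exists>x\<in>carrier_vec ?m. ?J *\<^sub>v x = y) \<longleftrightarrow>
      surjective_along n (\<lambda>p. A $$ p) (set ps)"
    if ps: "distinct ps" and pos: "\<forall>p\<in>set ps. p \<in> positions n"
  proof -
    have apply_J: "(?J *\<^sub>v vec ?m (\<lambda>l. E (ps ! l))) $ i =
        (\<Sum>p\<in>positions n. ?d (n - (i + 1)) p * E p)"
      if i: "i < n" and E: "\<And>p. p \<notin> set ps \<Longrightarrow> E p = 0" for i E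
    proof -
      have "(?J *\<^sub>v vec ?m (\<lambda>l. E (ps ! l))) $ i =
          (\<Sum>l<?m. ?d (n - (i + 1)) (ps ! l) * E (ps ! l))"
        using J i by (simp add: scalar_prod_def jacobian_mat_index[OF A ps] atLeast0LessThan)
      also have "\<dots> = (\<Sum>p\<in>set ps. ?d (n - (i + 1)) p * E p)"
        by (rule sum.reindex_bij_betw[OF bij_betw_nth[OF ps refl refl]])
      also have "\<dots> = (\<Sum>p\<in>positions n. ?d (n - (i + 1)) p * E p)"
        using pos E by (intro sum.mono_neutral_left) auto
      finally show ?thesis .
    qed
    show ?thesis
    proof
      assume surj: "\<forall>y\<in>carrier_vec n. \<exists>x\<in>carrier_vec ?m. ?J *\<^sub>v x = y"
      show "surjective_along n (\<lambda>p. A $$ p) (set ps)"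
        unfolding surjective_along_def
      proof
        fix u :: "nat \<Rightarrow> real"
        have "vec n (\<lambda>i. u (n - (i + 1))) \<in> carrier_vec n" by simp
        from surj[rule_format, OF this] obtain x
          where x: "x \<in> carrier_vec ?m" and Jx: "?J *\<^sub>v x = vec n (\<lambda>i. u (n - (i + 1)))"
          by blast
        define E where "E p = (case map_of (zip ps (list_of_vec x)) p of None \<Rightarrow> 0 | Some t \<Rightarrow> t)" for p
        have E0: "E p = 0" if "p \<notin> set ps" for p
        proof -
          have "map_of (zip ps (list_of_vec x)) p = None" using that x by simp
          then show ?thesis by (simp add: E_def)
        qed
        have "E (ps ! l) = x $ l" if "l < ?m" for l
          using that x ps by (simp add: E_def map_of_zip_nth list_of_vec_index)
        then have xE: "vec ?m (\<lambda>l. E (ps ! l)) = x" using x by (intro eq_vecI) auto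
        have "(\<Sum>p\<in>positions n. ?d i p * E p) = u i" if "i < n" for i
          using apply_J[of "n - (i + 1)" E] E0 that by (simp add: xE Jx)
        with E0 show "\<exists>E. (\<forall>p. p \<notin> set ps \<longrightarrow> E p = 0) \<and>
            (\<forall>i<n. (\<Sum>p\<in>positions n. ?d i p * E p) = u i)"
          by blast
      qed
    next
      assume surj: "surjective_along n (\<lambda>p. A $$ p) (set ps)"
      show "\<forall>y\<in>carrier_vec n. \<exists>x\<in>carrier_vec ?m. ?J *\<^sub>v x = y"
      proof
        fix y :: "real vec" assume y: "y \<in> carrier_vec n"
        from spec[OF surj[unfolded surjective_along_def], of "\<lambda>i. y $ (n - (i + 1))"]
        obtain E where E: "\<And>p. p \<notin> set ps \<Longrightarrow> E p = 0"
          "\<And>i. i < n \<Longrightarrow> (\<Sum>p\<in>positions n. ?d i p * E p) = y $ (n - (i + 1))"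
          by auto
        have "?J *\<^sub>v vec ?m (\<lambda>l. E (ps ! l)) = y"
        proof (intro eq_vecI)
          fix i assume "i < dim_vec y"
          then have i: "i < n" using y by simp
          have "(?J *\<^sub>v vec ?m (\<lambda>l. E (ps ! l))) $ i =
              (\<Sum>p\<in>positions n. ?d (n - (i + 1)) p * E p)"
            by (rule apply_J[OF i]) (rule E(1))
          also have "\<dots> = y $ (n - (n - (i + 1) + 1))" using i by (intro E(2)) simp
          also have "n - (n - (i + 1) + 1) = i" using i by simp
          finally show "(?J *\<^sub>v vec ?m (\<lambda>l. E (ps ! l))) $ i = y $ i" .
        qed (use J y in simp)
        then show "\<exists>x\<in>carrier_vec ?m. ?J *\<^sub>v x = y" by (intro bexI[of _ "vec ?m (\<lambda>l. E (ps ! l))"]) auto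
      qed
    qed
  qed
  then have "rank ?J = n \<longleftrightarrow> surjective_along n (\<lambda>p. A $$ p) (set ps)"
    if "distinct ps" "\<forall>p\<in>set ps. p \<in> positions n"
    using that rank_eq_dim_iff_surjective[OF J] by blast
  moreover have "n \<le> ?m" if "rank ?J = n" using rank_le_nc[OF J] that by simp
  moreover have "(\<forall>(r, s)\<in>set ps. r < dim_row A \<and> s < dim_col A \<and> A $$ (r, s) \<noteq> 0) \<longleftrightarrow>
      (\<forall>p\<in>set ps. p \<in> positions n \<and> A $$ p \<noteq> 0)"
    using A by auto
  moreover have "(\<forall>p\<in>set ps. p \<in> positions n \<and> A $$ p \<noteq> 0) \<Longrightarrow> \<forall>p\<in>set ps. p \<in> positions n"
    by blast
  moreover have "dim_row A = n" using A by simp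
  ultimately show ?thesis unfolding full_rank_choice_def by argo
qed

section \<open>A fixed point lemma\<close>

text \<open>
  Functions on \<open>nat\<close> of which only the first \<open>n\<close> values count stand in for vectors, because the
  dimension is a variable of the theorem and not a type. The displacement \<open>T y - y\<close> has a smallest
  norm on a compact product of intervals, and one more application of \<open>T\<close> would halve it.
\<close>
lemma l1_contraction_fixpoint:
  fixes T :: "(nat \<Rightarrow> real) \<Rightarrow> nat \<Rightarrow> real" and n :: nat and r :: real
  defines "N \<equiv> \<lambda>y. \<Sum>i<n. \<bar>y i\<bar>"
  assumes r: "r \<ge> 0"
    and contr: "\<And>x y. N x \<le> r \<Longrightarrow> N y \<le> r \<Longrightarrow> N (\<lambda>i. T x i - T y i) \<le> 1/2 * N (\<lambda>i. x i - y i)"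
    and self: "N (T (\<lambda>i. 0)) \<le> r / 2"
  obtains y where "N y \<le> r" "\<And>i. i < n \<Longrightarrow> T y i = y i"
proof -
  define K where "K = Pi\<^sub>E UNIV (\<lambda>i. if i < n then {-r..r} else {0}) \<inter> {y. N y \<le> r}"
  let ?F = "\<lambda>y. N (\<lambda>i. T y i - y i)"
  have N_cong: "N x = N y" if "\<And>i. i < n \<Longrightarrow> x i = y i" for x y
    unfolding N_def by (rule sum.cong) (simp_all add: that)
  have N_tri: "N (\<lambda>i. x i + y i) \<le> N x + N y" for x y
    unfolding N_def sum.distrib[symmetric] by (intro sum_mono abs_triangle_ineq)
  have N_ge: "\<bar>y i\<bar> \<le> N y" if "i < n" for i y
    unfolding N_def by (rule member_le_sum) (use that in auto)
  have cont_N: "continuous_on UNIV N"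
    unfolding N_def by (intro continuous_intros continuous_on_product_coordinates)
  have "compact (Pi\<^sub>E UNIV (\<lambda>i. if i < n then {-r..r} else {0::real}))"
    using compactin_PiE[of "\<lambda>_. euclidean" UNIV "\<lambda>i. if i < n then {-r..r} else {0::real}"]
    by (simp add: euclidean_product_topology)
  moreover have "closed {y. N y \<le> r}"
    using cont_N by (intro closed_Collect_le) auto
  ultimately have K: "compact K" unfolding K_def by (rule compact_Int_closed)
  have memK: "(\<lambda>i. if i < n then y i else 0) \<in> K" if "N y \<le> r" for y
  proof -
    have "N (\<lambda>i. if i < n then y i else 0) = N y" by (rule N_cong) simp
    moreover have "\<bar>y i\<bar> \<le> r" if "i < n" for i using N_ge[OF that, of y] \<open>N y \<le> r\<close> by simp
    ultimately show ?thesis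
      unfolding K_def using \<open>N y \<le> r\<close> by (auto simp: PiE_def abs_le_iff) (metis minus_le_iff)
  qed
  have cont_T: "continuous_on K (\<lambda>y. T y i)" if i: "i < n" for i
    unfolding continuous_on_def
  proof
    fix y assume y: "y \<in> K"
    have "((\<lambda>x. N (\<lambda>j. x j - y j)) \<longlongrightarrow> N (\<lambda>j. y j - y j)) (at y within K)"
      unfolding N_def
      by (intro tendsto_intros continuous_on_product_coordinates[THEN continuous_on_subset,
            unfolded continuous_on_def, rule_format, of K y]) (use y in auto)
    then have "((\<lambda>x. 1/2 * N (\<lambda>j. x j - y j)) \<longlongrightarrow> 0) (at y within K)"
      using tendsto_mult_right_zero[of "\<lambda>x. N (\<lambda>j. x j - y j)" _ "1/2"] by (simp add: N_def)
    moreover have "\<forall>\<^sub>F x in at y within K. norm (T x i - T y i) \<le> 1/2 * N (\<lambda>j. x j - y j)"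
      unfolding eventually_at_filter
    proof (intro always_eventually allI impI)
      fix x assume "x \<in> K"
      with y have "N (\<lambda>i. T x i - T y i) \<le> 1/2 * N (\<lambda>i. x i - y i)"
        by (intro contr) (auto simp: K_def)
      with N_ge[OF i, of "\<lambda>i. T x i - T y i"]
      show "norm (T x i - T y i) \<le> 1/2 * N (\<lambda>j. x j - y j)" by simp
    qed
    ultimately have "((\<lambda>x. T x i - T y i) \<longlongrightarrow> 0) (at y within K)"
      by (rule Lim_null_comparison[rotated])
    then show "((\<lambda>y. T y i) \<longlongrightarrow> T y i) (at y within K)"
      by (simp add: LIM_zero_iff)
  qed
  have cont: "continuous_on K ?F"
    unfolding N_def by (intro continuous_intros cont_T
       continuous_on_subset[OF continuous_on_product_coordinates]) auto
  have "K \<noteq> {}" using memK[of "\<lambda>_. 0"] r by (auto simp: N_def)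
  then obtain y where y: "y \<in> K" and min: "\<And>x. x \<in> K \<Longrightarrow> ?F y \<le> ?F x"
    using continuous_attains_inf[OF K _ cont] by blast
  have Ny: "N y \<le> r" using y by (simp add: K_def)
  have "N (T y) \<le> r"
  proof -
    have "N (T y) = N (\<lambda>i. (T y i - T (\<lambda>i. 0) i) + T (\<lambda>i. 0) i)" by (rule N_cong) simp
    also have "\<dots> \<le> N (\<lambda>i. T y i - T (\<lambda>i. 0) i) + N (T (\<lambda>i. 0))" by (rule N_tri)
    also have "N (\<lambda>i. T y i - T (\<lambda>i. 0) i) \<le> 1/2 * N (\<lambda>i. y i - 0)"
      using Ny r by (intro contr) (auto simp: N_def)
    finally show ?thesis using Ny self by simp
  qed
  \<comment> \<open>The minimum of the displacement is zero, since applying \<open>T\<close> once more halves it.\<close>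
  define x where "x = (\<lambda>i. if i < n then T y i else 0)"
  have "x \<in> K" unfolding x_def by (rule memK) fact
  then have "?F y \<le> ?F x" by (rule min)
  also have "\<dots> = N (\<lambda>i. T x i - T y i)" by (rule N_cong) (simp add: x_def)
  also have "\<dots> \<le> 1/2 * N (\<lambda>i. x i - y i)"
    using \<open>x \<in> K\<close> Ny by (intro contr) (auto simp: K_def)
  also have "N (\<lambda>i. x i - y i) = ?F y" by (rule N_cong) (simp add: x_def)
  finally have "?F y \<le> 0" by simp
  then have "T y i = y i" if "i < n" for i
    using N_ge[OF that, of "\<lambda>i. T y i - y i"] by simp
  then show ?thesis using Ny that by blast
qed

section \<open>Attaining nearby characteristic polynomials on a superpattern\<close>

text \<open>
  An inverse function theorem with a parameter. Let the columns \<open>G j\<close> be a right inverse of the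
  differential supported on the chosen positions, and put
  \<open>X y = A + (\<Sum>j. y j * G j) + \<epsilon> * \<sigma>\<close>, where \<open>\<sigma>\<close> holds the signs that the superpattern adds at the
  zero entries of \<open>A\<close>. The map \<open>y \<mapsto> y - (coefficients of X y - q)\<close> has differential close to zero,
  hence is a contraction, and its fixed points are the solutions of \<open>coefficients of X y = q\<close>. The
  constants are chosen so that \<open>X y\<close> stays too close to \<open>A\<close> for a nonzero entry to change sign.
\<close>
theorem char_coeffs_locally_surjective_on_superpattern:
  assumes A: "A \<in> carrier_mat n n" and choice: "full_rank_choice A ps"
    and S: "superpattern S (sgn_mat A)"
  obtains \<eta> where "\<eta> > 0"
    "\<And>q. (\<And>i. i < n \<Longrightarrow> \<bar>q i - coeff (char_poly A) i\<bar> \<le> \<eta>) \<Longrightarrow>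
       \<exists>M\<in>qual_class S. \<forall>i<n. coeff (char_poly M) i = q i"
proof -
  define a where "a = (\<lambda>p. A $$ p)"
  let ?I = "positions n" and ?F = "box_pairs (positions n) a"
  have a_mat: "mat n n a = A" unfolding a_def by (rule mat_of_entries[OF A])
  have ps: "\<And>p. p \<in> set ps \<Longrightarrow> a p \<noteq> 0" and surj: "surjective_along n a (set ps)"
    using choice full_rank_choice_iff_surjective_along[OF A] unfolding a_def by blast+
  have "\<exists>E. (\<forall>p. p \<notin> set ps \<longrightarrow> E p = 0) \<and>
      (\<forall>i<n. (\<Sum>p\<in>?I. char_partial n a i p * E p) = (if i = j then 1 else 0))" for j
    using surj unfolding surjective_along_def by (rule spec)
  then obtain G where G0: "\<And>j p. p \<notin> set ps \<Longrightarrow> G j p = 0"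
    and G: "\<And>j i. i < n \<Longrightarrow> (\<Sum>p\<in>?I. char_partial n a i p * G j p) = (if i = j then 1 else 0)"
    by metis
  define \<sigma> where "\<sigma> = (\<lambda>p. if a p \<noteq> 0 then 0 else
     (case S $$ p of Zero \<Rightarrow> 0 | Plus \<Rightarrow> 1 | Minus \<Rightarrow> - (1 :: real)))"
  have \<sigma>_le: "\<bar>\<sigma> p\<bar> \<le> 1" for p by (auto simp: \<sigma>_def split: sign.split)
  obtain Q where Q: "\<And>i. has_slopes ?I a (char_coeff n i) (Q i)"
    using sloped_char_coeff by metis
  define C where "C i j z = (\<Sum>p\<in>?I. Q i p z * G j p)" for i j z
  define D where "D i z = (\<Sum>p\<in>?I. Q i p z * \<sigma> p)" for i z
  have Q_lim: "(Q i p \<longlongrightarrow> Q i p (a, a)) ?F" if "p \<in> ?I" for i p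
    using Q that unfolding has_slopes_def by blast
  have Q_eq: "char_coeff n i x - char_coeff n i y = (\<Sum>p\<in>?I. Q i p (x, y) * (x p - y p))" for i x y
    using Q unfolding has_slopes_def by blast
  have C_lim: "(C i j \<longlongrightarrow> (if i = j then 1 else 0)) ?F" if "i < n" for i j
  proof -
    have "(C i j \<longlongrightarrow> C i j (a, a)) ?F"
      unfolding C_def by (intro tendsto_intros Q_lim)
    also have "C i j (a, a) = (if i = j then 1 else 0)"
      unfolding C_def G[OF that, of j, symmetric]
      by (intro sum.cong) (simp_all add: slopes_char_coeff_eq_partial[OF Q])
    finally show ?thesis .
  qed
  have D_lim: "(D i \<longlongrightarrow> D i (a, a)) ?F" for i
    unfolding D_def by (intro tendsto_intros Q_lim)
  \<comment> \<open>If each of the \<open>n\<^sup>2\<close> slopes deviates from the identity matrix by at most \<open>c\<close>, the Lipschitz constant in the \<open>l1\<close> norm is at most \<open>1/2\<close>.\<close>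
  define c where "c = 1 / (2 * (real n + 1))"
  have c: "c > 0" "real n * c \<le> 1/2" by (auto simp: c_def field_simps)
  define L where "L = (\<Sum>i<n. \<bar>D i (a, a)\<bar> + 1)"
  have L: "L \<ge> 0" unfolding L_def by (intro sum_nonneg) simp
  have "\<forall>\<^sub>F z in ?F. \<bar>C i j z - (if i = j then 1 else 0)\<bar> < c" if "i < n" for i j
    using tendstoD[OF C_lim[OF that] c(1)] by (simp add: dist_real_def)
  moreover have "\<forall>\<^sub>F z in ?F. \<bar>D i z\<bar> \<le> L" if "i < n" for i
  proof -
    have "\<bar>D i (a, a)\<bar> + 1 \<le> L"
      unfolding L_def by (rule member_le_sum) (use that in auto)
    then have "\<bar>D i (a, a)\<bar> < L" by simp
    from order_tendstoD(2)[OF tendsto_rabs[OF D_lim] this] show ?thesis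
      by eventually_elim simp
  qed
  ultimately have "\<forall>\<^sub>F z in ?F. (\<forall>i\<in>{..<n}. \<forall>j\<in>{..<n}. \<bar>C i j z - (if i = j then 1 else 0)\<bar> < c) \<and>
      (\<forall>i\<in>{..<n}. \<bar>D i z\<bar> \<le> L)"
    by (intro eventually_conj eventually_ball_finite ballI finite_lessThan) (simp_all only: lessThan_iff)
  then obtain d0 where d0: "d0 > 0" and near: "\<And>x y. (\<And>p. p \<in> ?I \<Longrightarrow> \<bar>x p - a p\<bar> < d0 \<and> \<bar>y p - a p\<bar> < d0) \<Longrightarrow>
      (\<forall>i<n. \<forall>j<n. \<bar>C i j (x, y) - (if i = j then 1 else 0)\<bar> < c) \<and> (\<forall>i<n. \<bar>D i (x, y)\<bar> \<le> L)"
    unfolding eventually_box_pairs by (auto simp: Ball_def)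
  \<comment> \<open>Within distance \<open>d\<close> of \<open>A\<close> the nonzero entries of \<open>A\<close> keep their signs.\<close>
  define d where "d = Min (insert d0 ((\<lambda>p. \<bar>a p\<bar>) ` {p\<in>?I. a p \<noteq> 0}))"
  have d: "d > 0" "d \<le> d0" and d_le: "\<And>p. p \<in> ?I \<Longrightarrow> a p \<noteq> 0 \<Longrightarrow> d \<le> \<bar>a p\<bar>"
    unfolding d_def using d0 by (auto intro!: Min_le)
  define g where "g = 1 + (\<Sum>p\<in>?I. \<Sum>j<n. \<bar>G j p\<bar>)"
  have g: "g > 0" unfolding g_def by (intro add_pos_nonneg sum_nonneg) auto
  have G_le: "\<bar>G j p\<bar> \<le> g" if "p \<in> ?I" "j < n" for j p
  proof -
    have "\<bar>G j p\<bar> \<le> (\<Sum>j<n. \<bar>G j p\<bar>)" by (rule member_le_sum) (use that in auto)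
    also have "\<dots> \<le> (\<Sum>p\<in>?I. \<Sum>j<n. \<bar>G j p\<bar>)"
      by (rule member_le_sum[of p ?I "\<lambda>p. \<Sum>j<n. \<bar>G j p\<bar>"]) (use that in \<open>auto intro: sum_nonneg\<close>)
    finally show ?thesis by (simp add: g_def)
  qed
  define r where "r = d / (4 * g)"
  have r: "r > 0" "r * g = d / 4" using d g by (auto simp: r_def)
  \<comment> \<open>Half of the error \<open>2 * \<eta>\<close> per coefficient comes from the target \<open>q\<close>, half from the parameter \<open>\<epsilon>\<close>; the total \<open>2 * n * \<eta>\<close> is at most \<open>r / 2\<close>.\<close>
  define \<eta> where "\<eta> = r * c / 2"
  define \<epsilon> where "\<epsilon> = min (d / 4) (\<eta> / (L + 1))"
  have \<eta>: "\<eta> > 0" using r c by (simp add: \<eta>_def)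
  have \<epsilon>: "\<epsilon> > 0" "\<epsilon> \<le> d / 4" "\<epsilon> * L \<le> \<eta>"
  proof -
    show "\<epsilon> > 0" using d \<eta> L by (simp add: \<epsilon>_def)
    show "\<epsilon> \<le> d / 4" unfolding \<epsilon>_def by (rule min.cobounded1)
    have "\<epsilon> * L \<le> \<eta> / (L + 1) * (L + 1)"
      using \<open>\<epsilon> > 0\<close> L by (intro mult_mono) (auto simp: \<epsilon>_def)
    then show "\<epsilon> * L \<le> \<eta>" using L by simp
  qed
  define N where "N y = (\<Sum>i<n. \<bar>y i\<bar>)" for y :: "nat \<Rightarrow> real"
  define X where "X y = (\<lambda>p. a p + (\<Sum>j<n. y j * G j p) + \<epsilon> * \<sigma> p)" for y
  have X_near: "\<bar>X y p - a p\<bar> < d" if p: "p \<in> ?I" and y: "N y \<le> r" for y p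
  proof -
    have "\<bar>\<Sum>j<n. y j * G j p\<bar> \<le> (\<Sum>j<n. \<bar>y j\<bar> * g)"
      by (rule order_trans[OF sum_abs sum_mono]) (auto simp: abs_mult intro!: mult_left_mono G_le p)
    also have "\<dots> = N y * g" by (simp add: N_def sum_distrib_right)
    also have "\<dots> \<le> d / 4" using mult_right_mono[OF y, of g] g r(2) by simp
    finally have "\<bar>\<Sum>j<n. y j * G j p\<bar> \<le> d / 4" .
    moreover have "\<bar>\<epsilon> * \<sigma> p\<bar> \<le> d / 4"
      using mult_mono[of \<epsilon> "d/4" "\<bar>\<sigma> p\<bar>" 1] \<sigma>_le[of p] \<epsilon> d by (simp add: abs_mult)
    ultimately show ?thesis using d(1) unfolding X_def by linarith
  qed
  have N0: "N (\<lambda>i. 0) \<le> r" using r by (simp add: N_def)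
  show ?thesis
  proof (rule that[OF \<eta>])
    fix q assume q: "\<And>i. i < n \<Longrightarrow> \<bar>q i - coeff (char_poly A) i\<bar> \<le> \<eta>"
    define T where "T y = (\<lambda>i. y i - (char_coeff n i (X y) - q i))" for y
    have contr: "N (\<lambda>i. T x i - T y i) \<le> 1/2 * N (\<lambda>i. x i - y i)" if xy: "N x \<le> r" "N y \<le> r" for x y
    proof -
      have "\<bar>T x i - T y i\<bar> \<le> c * N (\<lambda>i. x i - y i)" if i: "i < n" for i
      proof -
        have "char_coeff n i (X x) - char_coeff n i (X y) =
            (\<Sum>p\<in>?I. Q i p (X x, X y) * (\<Sum>j<n. (x j - y j) * G j p))"
          by (simp add: Q_eq X_def left_diff_distrib sum_subtractf)
        also have "\<dots> = (\<Sum>j<n. C i j (X x, X y) * (x j - y j))"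
          unfolding C_def sum_distrib_left sum_distrib_right
          by (subst sum.swap) (simp add: ac_simps)
        finally have "T x i - T y i = (x i - y i) - (\<Sum>j<n. C i j (X x, X y) * (x j - y j))"
          by (simp add: T_def)
        also have "x i - y i = (\<Sum>j<n. (if i = j then 1 else 0) * (x j - y j))"
          using i by (simp add: if_distrib[of "\<lambda>c. c * _"] cong: if_cong)
        finally have "T x i - T y i = - (\<Sum>j<n. (C i j (X x, X y) - (if i = j then 1 else 0)) * (x j - y j))"
          by (simp add: left_diff_distrib sum_subtractf)
        also have "\<bar>\<dots>\<bar> \<le> (\<Sum>j<n. c * \<bar>x j - y j\<bar>)"
          unfolding abs_minus_cancel
        proof (rule order_trans[OF sum_abs sum_mono])
          fix j assume "j \<in> {..<n}"
          moreover have "\<bar>X x p - a p\<bar> < d0 \<and> \<bar>X y p - a p\<bar> < d0" if "p \<in> ?I" for p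
            using X_near[OF that xy(1)] X_near[OF that xy(2)] d(2) by simp
          ultimately have "\<bar>C i j (X x, X y) - (if i = j then 1 else 0)\<bar> \<le> c"
            using near i by (meson lessThan_iff less_imp_le)
          then show "\<bar>(C i j (X x, X y) - (if i = j then 1 else 0)) * (x j - y j)\<bar> \<le> c * \<bar>x j - y j\<bar>"
            unfolding abs_mult by (intro mult_right_mono) auto
        qed
        finally show ?thesis by (simp add: N_def sum_distrib_left)
      qed
      then have "N (\<lambda>i. T x i - T y i) \<le> (\<Sum>i<n. c * N (\<lambda>i. x i - y i))"
        unfolding N_def[of "\<lambda>i. T x i - T y i"] by (intro sum_mono) simp
      also have "\<dots> = (real n * c) * N (\<lambda>i. x i - y i)" by simp
      also have "\<dots> \<le> 1/2 * N (\<lambda>i. x i - y i)"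
        using c by (intro mult_right_mono) (auto simp: N_def sum_nonneg)
      finally show ?thesis .
    qed
    have self: "N (T (\<lambda>i. 0)) \<le> r / 2"
    proof -
      have "\<bar>T (\<lambda>i. 0) i\<bar> \<le> 2 * \<eta>" if i: "i < n" for i
      proof -
        have X0: "X (\<lambda>i. 0) = (\<lambda>p. a p + \<epsilon> * \<sigma> p)" by (simp add: X_def)
        have "char_coeff n i (X (\<lambda>i. 0)) - char_coeff n i a = \<epsilon> * D i (X (\<lambda>i. 0), a)"
          unfolding Q_eq D_def X0 by (simp add: sum_distrib_left ac_simps)
        moreover have "\<bar>D i (X (\<lambda>i. 0), a)\<bar> \<le> L"
        proof -
          have "\<bar>X (\<lambda>i. 0) p - a p\<bar> < d0 \<and> \<bar>a p - a p\<bar> < d0" if "p \<in> ?I" for p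
            using X_near[OF that N0] d by simp
          then show ?thesis using near i by blast
        qed
        ultimately have "\<bar>char_coeff n i (X (\<lambda>i. 0)) - char_coeff n i a\<bar> \<le> \<epsilon> * L"
          using \<epsilon> by (simp add: abs_mult)
        moreover have "char_coeff n i a = coeff (char_poly A) i"
          by (simp add: char_coeff_def a_mat)
        ultimately show ?thesis using q[OF i] \<epsilon>(3) by (simp add: T_def)
      qed
      then have "N (T (\<lambda>i. 0)) \<le> (\<Sum>i<n. 2 * \<eta>)" unfolding N_def by (intro sum_mono) simp
      also have "\<dots> = (real n * c) * r" by (simp add: \<eta>_def)
      also have "\<dots> \<le> 1/2 * r" using c r by (intro mult_right_mono) auto
      finally show ?thesis by simp
    qed
    obtain y where y: "N y \<le> r" and fp: "\<And>i. i < n \<Longrightarrow> T y i = y i"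
      using l1_contraction_fixpoint[of r n T] contr self r(1) unfolding N_def by auto
    let ?M = "mat n n (X y)"
    have "coeff (char_poly ?M) i = q i" if "i < n" for i
      using fp[OF that] by (simp add: T_def char_coeff_def)
    moreover have "?M \<in> qual_class S"
    proof -
      have dims: "dim_row S = n" "dim_col S = n"
        using S A by (auto simp: superpattern_def sgn_mat_def)
      have sign: "sign_of (X y p) = S $$ p" if p: "p \<in> ?I" for p
      proof (cases "a p = 0")
        case True
        then have "p \<notin> set ps" using ps by blast
        then have "X y p = \<epsilon> * \<sigma> p" using True by (simp add: X_def G0)
        then show ?thesis using True \<epsilon>(1)
          by (cases "S $$ p") (auto simp: \<sigma>_def sign_of_def mult_less_0_iff)
      next
        case False
        have "S $$ p = sign_of (a p)"
          using S A p False unfolding superpattern_def sgn_mat_def a_def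
          by (cases p) (auto simp: sign_of_def)
        moreover have "\<bar>X y p - a p\<bar> < \<bar>a p\<bar>" using X_near[OF p y] d_le[OF p False] by simp
        ultimately show ?thesis by (auto simp: sign_of_def)
      qed
      have "X y (i, j) = 0 \<and> S $$ (i, j) = Zero \<or> X y (i, j) > 0 \<and> S $$ (i, j) = Plus \<or>
          X y (i, j) < 0 \<and> S $$ (i, j) = Minus" if "i < n" "j < n" for i j
        using sign[of "(i, j)"] that by (auto simp: sign_of_def split: if_splits)
      then show ?thesis
        unfolding qual_class_def by (fastforce simp: dims)
    qed
    ultimately show "\<exists>M\<in>qual_class S. \<forall>i<n. coeff (char_poly M) i = q i" by blast
  qed
qed

section \<open>Counting roots by the sign of the real part\<close>

interpretation of_real_poly_hom: map_poly_inj_idom_hom "of_real :: real \<Rightarrow> complex" ..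

text \<open>Roots are counted with multiplicity, in the complex plane.\<close>
definition root_count :: "(complex \<Rightarrow> bool) \<Rightarrow> real poly \<Rightarrow> nat" where
  "root_count R p = size (filter_mset R (proots (map_poly complex_of_real p)))"

lemma num_eigenvalues_eq_root_count:
  assumes A: "A \<in> carrier_mat n n"
  shows "num_eigenvalues A R = root_count R (char_poly A)"
proof -
  let ?C = "map_mat complex_of_real A" and ?p = "map_poly complex_of_real (char_poly A)"
  have C: "?C \<in> carrier_mat n n" using A by simp
  have p: "char_poly ?C = ?p" by (rule of_real_hom.char_poly_hom[OF A])
  have nz: "?p \<noteq> 0" using degree_monic_char_poly[OF C] unfolding p by auto
  then have "root_count R (char_poly A) = (\<Sum>z\<in>{z. poly ?p z = 0 \<and> R z}. Polynomial.order z ?p)"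
    by (auto simp: root_count_def size_multiset_overloaded_eq intro!: sum.cong)
  then show ?thesis
    by (simp add: num_eigenvalues_def Let_def eigenvalue_root_char_poly[OF C] p)
qed

lemma root_count_mult:
  "p \<noteq> 0 \<Longrightarrow> q \<noteq> 0 \<Longrightarrow> root_count R (p * q) = root_count R p + root_count R q"
  by (simp add: root_count_def of_real_poly_hom.hom_mult proots_mult)

lemma root_count_1: "root_count R 1 = 0"
  by (simp add: root_count_def)

lemma root_count_linear: "root_count R [:- x, 1:] = of_bool (R (complex_of_real x))"
  by (simp add: root_count_def)

text \<open>The monic real polynomial with the roots \<open>s \<plusminus> \<i>\<beta>\<close>.\<close>
definition quad :: "real \<Rightarrow> real \<Rightarrow> real poly" where
  "quad s \<beta> = [:s\<^sup>2 + \<beta>\<^sup>2, - 2 * s, 1:]"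

lemma quad_nonzero [simp]: "quad s \<beta> \<noteq> 0" by (simp add: quad_def)

lemma root_count_quad:
  "root_count R (quad s \<beta>) = of_bool (R (Complex s \<beta>)) + of_bool (R (Complex s (- \<beta>)))"
proof -
  have "map_poly complex_of_real (quad s \<beta>) = [:- Complex s \<beta>, 1:] * [:- Complex s (- \<beta>), 1:]"
    by (simp add: quad_def complex_eq_iff power2_eq_square)
  then have "root_count R (quad s \<beta>) =
      size (filter_mset R (proots [:- Complex s \<beta>, 1:] + proots [:- Complex s (- \<beta>), 1:]))"
    by (simp only: root_count_def proots_mult pCons_eq_0_iff one_neq_zero simp_thms)
  then show ?thesis by simp
qed

lemma root_count_power: "p \<noteq> 0 \<Longrightarrow> root_count R (p ^ k) = k * root_count R p"
  by (induction k) (auto simp: root_count_mult root_count_1)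

lemma root_count_prod_list:
  "(\<And>p. p \<in> set ps \<Longrightarrow> p \<noteq> 0) \<Longrightarrow> root_count R (prod_list ps) = (\<Sum>p\<leftarrow>ps. root_count R p)"
proof (induction ps)
  case (Cons p ps)
  then have "p \<noteq> 0" "prod_list ps \<noteq> 0" by (auto simp: prod_list_zero_iff)
  then show ?case using Cons by (simp add: root_count_mult)
qed (simp add: root_count_1)

text \<open>
  Split off one real factor after another: a root \<open>0\<close> gives the factor \<open>z\<close>, and any other root \<open>\<i>y\<close>
  gives \<open>z\<^sup>2 + y\<^sup>2\<close>, since the remainder modulo that quadratic is a real linear polynomial vanishing at \<open>\<i>y\<close>.
\<close>
lemma imaginary_rooted_factorization:
  assumes "monic p" and "\<And>z. poly (map_poly complex_of_real p) z = 0 \<Longrightarrow> Re z = 0"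
  shows "\<exists>c \<beta>s. 0 \<notin> set \<beta>s \<and> p = [:0, 1:] ^ c * prod_list (map (quad 0) \<beta>s)"
  using assms
proof (induction "degree p" arbitrary: p rule: less_induct)
  case less
  let ?C = "map_poly complex_of_real"
  have p0: "p \<noteq> 0" using less.prems(1) by auto
  have step: "\<exists>c \<beta>s. 0 \<notin> set \<beta>s \<and> q = [:0, 1:] ^ c * prod_list (map (quad 0) \<beta>s)"
    if pq: "p = f * q" and f: "monic f" "degree f > 0" for f q
  proof (rule less.hyps)
    have "f \<noteq> 0" "q \<noteq> 0" using pq p0 by auto
    then show "degree q < degree p" using f by (simp add: pq degree_mult_eq)
    show "monic q" using less.prems(1) f(1) by (simp add: pq lead_coeff_mult)
    show "Re z = 0" if "poly (?C q) z = 0" for z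
      using less.prems(2)[of z] that by (simp add: pq of_real_poly_hom.hom_mult)
  qed
  show ?case
  proof (cases "degree p = 0")
    case True
    then have "p = 1" using less.prems(1) by (metis degree_0_id one_pCons of_nat_1 coeff_const degree_eq_zeroE)
    then show ?thesis by (intro exI[of _ 0] exI[of _ "[]"]) simp
  next
    case False
    then have "\<not> constant (poly (?C p))" by (simp add: constant_degree)
    then obtain z where z: "poly (?C p) z = 0" using fundamental_theorem_of_algebra by blast
    define y where "y = Im z"
    have zy: "z = Complex 0 y" using less.prems(2)[OF z] by (simp add: complex_eq_iff y_def)
    show ?thesis
    proof (cases "y = 0")
      case True
      then have "poly p 0 = 0"
        using z by (simp add: zy Complex_eq poly_0_coeff_0)
      then obtain q where q: "p = [:0, 1:] * q" by (metis poly_eq_0_iff_dvd dvdE neg_0_equal_iff_equal)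
      with step[OF q] obtain c \<beta>s where "0 \<notin> set \<beta>s" "q = [:0, 1:] ^ c * prod_list (map (quad 0) \<beta>s)"
        by auto
      then show ?thesis unfolding q by (intro exI[of _ "Suc c"] exI[of _ \<beta>s]) simp
    next
      case False
      define r where "r = p mod quad 0 y"
      have p_eq: "p = quad 0 y * (p div quad 0 y) + r" by (simp add: r_def)
      have "degree r < 2" using degree_mod_less[of "quad 0 y" p] by (auto simp: r_def quad_def)
      then obtain r0 r1 where r: "r = [:r0, r1:]"
        by (metis One_nat_def Suc_1 degree_0_id degree1_coeffs less_2_cases pCons_0_0 )
      have "poly (?C (quad 0 y)) z = 0"
        by (simp add: quad_def zy complex_eq_iff power2_eq_square)
      then have "poly (?C r) z = 0"
        using z by (subst (asm) p_eq) (simp add: of_real_poly_hom.hom_mult of_real_poly_hom.hom_add)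
      moreover have "?C r = [:complex_of_real r0, complex_of_real r1:]"
        by (rule poly_eqI) (simp add: r coeff_map_poly coeff_pCons split: nat.split)
      ultimately have "r = 0" using False by (simp add: r zy complex_eq_iff)
      with p_eq have q: "p = quad 0 y * (p div quad 0 y)" by simp
      from step[OF q] obtain c \<beta>s where "0 \<notin> set \<beta>s"
        "p div quad 0 y = [:0, 1:] ^ c * prod_list (map (quad 0) \<beta>s)"
        by (auto simp: quad_def)
      then show ?thesis using False
        by (subst q, intro exI[of _ c] exI[of _ "y # \<beta>s"]) (simp add: ac_simps)
    qed
  qed
qed


section \<open>Every inertia near a polynomial with imaginary roots\<close>

text \<open>
  Conjugate pairs must go together: \<open>p\<close>, \<open>q\<close>, \<open>r\<close> count the pairs that end up in the right half plane,
  in the left half plane and on the imaginary axis. Rounding \<open>a\<close>, \<open>b\<close>, \<open>c\<close> down to even numbers loses at most 3 in total, and by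
  parity at most 2 unless \<open>c1\<close> is odd, hence at least 3; so enough room for \<open>L\<close> pairs remains. Greedy
  choice works.
\<close>
lemma inertia_split:
  fixes a b c c1 L :: nat
  assumes "a + b + c = c1 + 2 * L" "c1 \<ge> 2"
  obtains p q r where "p + q + r = L" "2 * p \<le> a" "2 * q \<le> b" "2 * r \<le> c"
proof -
  let ?p = "min (a div 2) L" and ?q = "min (b div 2) (L - min (a div 2) L)"
  have "a \<le> 2 * (a div 2) + 1" "b \<le> 2 * (b div 2) + 1" by linarith+
  then have "2 * (L - ?p - ?q) \<le> c"
    using assms unfolding min_def by (simp split: if_split; linarith)
  moreover have "?p + ?q + (L - ?p - ?q) = L" "2 * ?p \<le> a" "2 * ?q \<le> b" by auto
  ultimately show ?thesis using that by blast
qed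

lemma isCont_coeff_mult:
  fixes f g :: "real \<Rightarrow> real poly"
  assumes "\<And>k. isCont (\<lambda>t. coeff (f t) k) x" "\<And>k. isCont (\<lambda>t. coeff (g t) k) x"
  shows "isCont (\<lambda>t. coeff (f t * g t) k) x"
  unfolding coeff_mult by (intro continuous_intros assms)

lemma isCont_coeff_power:
  fixes f :: "real \<Rightarrow> real poly"
  assumes "\<And>k. isCont (\<lambda>t. coeff (f t) k) x"
  shows "isCont (\<lambda>t. coeff (f t ^ m) k) x"
  by (induction m arbitrary: k) (auto intro: isCont_coeff_mult assms)

lemma isCont_coeff_prod_list:
  fixes f :: "real \<Rightarrow> 'a \<Rightarrow> real poly"
  assumes "\<And>y k. y \<in> set ys \<Longrightarrow> isCont (\<lambda>t. coeff (f t y) k) x"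
  shows "isCont (\<lambda>t. coeff (prod_list (map (f t) ys)) k) x"
  using assms by (induction ys arbitrary: k) (auto intro: isCont_coeff_mult)

text \<open>All roots lie on the vertical line with real part \<open>s\<close>: the point \<open>s\<close> itself \<open>e\<close> times, and \<open>s \<plusminus> \<i>\<beta>\<close>.\<close>
definition line_poly :: "real \<Rightarrow> nat \<Rightarrow> real list \<Rightarrow> real poly" where
  "line_poly s e \<beta>s = [:- s, 1:] ^ e * prod_list (map (quad s) \<beta>s)"

lemma monic_quad: "monic (quad s \<beta>)" and degree_quad: "degree (quad s \<beta>) = 2"
  by (simp_all add: quad_def)

lemma monic_prod_quads: "monic (prod_list (map (quad s) \<beta>s))"
  by (rule monic_prod_list) (auto simp: monic_quad)

lemma monic_line_poly: "monic (line_poly s e \<beta>s)"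
  unfolding line_poly_def by (intro monic_mult monic_power monic_prod_quads) simp

lemma monic_imp_nonzero: "monic (p :: real poly) \<Longrightarrow> p \<noteq> 0"
  by auto

lemma degree_line_poly: "degree (line_poly s e \<beta>s) = e + 2 * length \<beta>s"
proof -
  have "degree (prod_list (map (quad s) \<beta>s)) = 2 * length \<beta>s"
  proof (induction \<beta>s)
    case (Cons x xs)
    have "degree (quad s x * prod_list (map (quad s) xs)) = 2 + degree (prod_list (map (quad s) xs))"
      by (subst degree_mult_eq[OF quad_nonzero monic_imp_nonzero[OF monic_prod_quads]])
         (simp only: degree_quad)
    then show ?case using Cons by simp
  qed simp
  moreover have "degree (line_poly s e \<beta>s) = e + degree (prod_list (map (quad s) \<beta>s))"
    unfolding line_poly_def
    by (subst degree_mult_eq[OF _ monic_imp_nonzero[OF monic_prod_quads]]) (simp_all add: degree_power_eq)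
  ultimately show ?thesis by simp
qed

lemma root_count_line_poly:
  "root_count R (line_poly s e \<beta>s) = e * of_bool (R (Complex s 0)) +
     (\<Sum>\<beta>\<leftarrow>\<beta>s. of_bool (R (Complex s \<beta>)) + of_bool (R (Complex s (- \<beta>))))"
proof -
  have "root_count R (line_poly s e \<beta>s) =
      root_count R ([:- s, 1:] ^ e) + root_count R (prod_list (map (quad s) \<beta>s))"
    unfolding line_poly_def
    by (intro root_count_mult monic_imp_nonzero monic_prod_quads monic_power) simp
  also have "root_count R ([:- s, 1:] ^ e) = e * of_bool (R (Complex s 0))"
    by (subst root_count_power) (simp_all add: root_count_linear complex_of_real_def)
  also have "root_count R (prod_list (map (quad s) \<beta>s)) = (\<Sum>p\<leftarrow>map (quad s) \<beta>s. root_count R p)"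
    by (rule root_count_prod_list) auto
  also have "\<dots> = (\<Sum>\<beta>\<leftarrow>\<beta>s. of_bool (R (Complex s \<beta>)) + of_bool (R (Complex s (- \<beta>))))"
    by (simp add: o_def root_count_quad)
  finally show ?thesis .
qed

lemma root_count_line_poly_const:
  assumes "\<And>y. R (Complex s y) \<longleftrightarrow> S"
  shows "root_count R (line_poly s e \<beta>s) = (if S then e + 2 * length \<beta>s else 0)"
  by (simp add: root_count_line_poly assms sum_list_triv)

lemma isCont_coeff_pCons:
  fixes f :: "real \<Rightarrow> real"
  assumes "isCont f x" "\<And>k. isCont (\<lambda>t. coeff (g t) k) x"
  shows "isCont (\<lambda>t. coeff (pCons (f t) (g t)) k) x"
  by (cases k) (simp_all add: assms)

lemma isCont_coeff_line_poly:
  fixes s :: "real \<Rightarrow> real"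
  assumes "isCont s x"
  shows "isCont (\<lambda>t. coeff (line_poly (s t) e \<beta>s) k) x"
  unfolding line_poly_def quad_def
  by (intro isCont_coeff_mult isCont_coeff_power isCont_coeff_prod_list isCont_coeff_pCons
        continuous_intros assms)

text \<open>
  Distribute the roots of \<open>p\<close> over three groups of sizes \<open>a\<close>, \<open>b\<close>, \<open>c\<close>, keeping conjugate pairs together,
  and shift the first group to the right and the second to the left by a small \<open>t\<close>.
\<close>
lemma nearby_polys_of_every_inertia:
  assumes p: "monic p" "degree p = n"
    and imag: "root_count (\<lambda>z. Re z > 0) p = 0" "root_count (\<lambda>z. Re z < 0) p = 0"
    and zero: "root_count (\<lambda>z. z = 0) p \<ge> 2"
    and abc: "a + b + c = n" and \<eta>: "\<eta> > (0::real)"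
  obtains q where "monic q" "degree q = n" "\<And>i. i < n \<Longrightarrow> \<bar>coeff q i - coeff p i\<bar> \<le> \<eta>"
    "root_count (\<lambda>z. Re z > 0) q = a" "root_count (\<lambda>z. Re z < 0) q = b"
    "root_count (\<lambda>z. Re z = 0) q = c"
proof -
  let ?C = "map_poly complex_of_real"
  have "p \<noteq> 0" using p by auto
  then have "?C p \<noteq> 0" by simp
  have "\<not> R z" if "poly (?C p) z = 0" "root_count R p = 0" for z R
  proof
    assume "R z"
    then have "z \<in># filter_mset R (proots (?C p))" using that \<open>?C p \<noteq> 0\<close> by simp
    then show False using that(2)
      by (simp only: root_count_def size_eq_0_iff_empty set_mset_empty empty_iff)
  qed
  then have "Re z = 0" if "poly (?C p) z = 0" for z
    using that imag by (meson linorder_neqE_linordered_idom)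
  then obtain c1 \<beta>s where \<beta>s: "0 \<notin> set \<beta>s" and p_eq: "p = line_poly 0 c1 \<beta>s"
    using imaginary_rooted_factorization[OF p(1)] unfolding line_poly_def by auto
  have "root_count (\<lambda>z. z = 0) p = c1 + (\<Sum>\<beta>\<leftarrow>\<beta>s. 0)"
    unfolding p_eq root_count_line_poly using \<beta>s
    by (intro arg_cong2[of _ _ _ _ "(+)"] arg_cong[of _ _ sum_list] map_cong refl)
       (auto simp: complex_eq_iff)
  then have c1: "c1 \<ge> 2" using zero by simp
  have n: "n = c1 + 2 * length \<beta>s"
    unfolding p(2)[symmetric] p_eq by (rule degree_line_poly)
  from abc have "a + b + c = c1 + 2 * length \<beta>s" by (simp add: n)
  then obtain k l m where klm: "k + l + m = length \<beta>s" "2 * k \<le> a" "2 * l \<le> b" "2 * m \<le> c"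
    using c1 by (rule inertia_split)
  define xs ys zs where "xs = take k \<beta>s" and "ys = take l (drop k \<beta>s)" and "zs = drop l (drop k \<beta>s)"
  have split: "\<beta>s = xs @ ys @ zs"
    unfolding xs_def ys_def zs_def by (simp only: append_take_drop_id)
  have len: "length xs = k" "length ys = l" "length zs = m"
    using klm(1) by (auto simp: xs_def ys_def zs_def)
  define a' b' c' where "a' = a - 2 * k" and "b' = b - 2 * l" and "c' = c - 2 * m"
  have abc': "a = a' + 2 * k" "b = b' + 2 * l" "c = c' + 2 * m" "c1 = a' + b' + c'"
    using klm abc n by (auto simp: a'_def b'_def c'_def)
  define q where "q t = line_poly t a' xs * (line_poly (- t) b' ys * line_poly 0 c' zs)" for t
  have q0: "q 0 = p"
    by (simp add: q_def p_eq line_poly_def split abc'(4) power_add ac_simps)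
  have monic_q: "monic (q t)" for t
    unfolding q_def by (intro monic_mult monic_line_poly)
  note nz = monic_imp_nonzero[OF monic_line_poly] monic_imp_nonzero[OF monic_mult[OF monic_line_poly monic_line_poly]]
  have deg_q: "degree (q t) = n" for t
  proof -
    have "degree (q t) = degree (line_poly t a' xs) + (degree (line_poly (- t) b' ys) + degree (line_poly 0 c' zs))"
      unfolding q_def by (subst degree_mult_eq[OF nz], subst degree_mult_eq[OF nz(1,1)]) (rule refl)
    then show ?thesis using abc by (simp only: degree_line_poly len abc'(1-3))
  qed
  have count_q: "root_count R (q t) = root_count R (line_poly t a' xs) +
      (root_count R (line_poly (- t) b' ys) + root_count R (line_poly 0 c' zs))" for R t
    unfolding q_def by (subst root_count_mult[OF nz], subst root_count_mult[OF nz(1,1)]) (rule refl)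
  have cont: "isCont (\<lambda>t. coeff (q t) i) 0" for i
    unfolding q_def
    by (intro isCont_coeff_mult isCont_coeff_line_poly continuous_intros)
  have "\<forall>\<^sub>F t in at_right 0. \<forall>i\<in>{..<n}. dist (coeff (q t) i) (coeff (q 0) i) < \<eta>"
  proof (intro eventually_ball_finite ballI finite_lessThan)
    fix i
    have "\<forall>\<^sub>F t in at 0. dist (coeff (q t) i) (coeff (q 0) i) < \<eta>"
      using cont \<eta> unfolding isCont_def by (rule tendstoD)
    then show "\<forall>\<^sub>F t in at_right 0. dist (coeff (q t) i) (coeff (q 0) i) < \<eta>"
      by (rule filter_leD[OF at_le, rotated]) simp
  qed
  moreover have "\<forall>\<^sub>F t::real in at_right 0. t > 0" by (rule eventually_at_right_less)
  ultimately have "\<forall>\<^sub>F t in at_right 0. t > 0 \<and> (\<forall>i\<in>{..<n}. dist (coeff (q t) i) (coeff (q 0) i) < \<eta>)"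
    by eventually_elim blast
  then obtain t where t: "t > 0" and near: "\<forall>i\<in>{..<n}. dist (coeff (q t) i) (coeff (q 0) i) < \<eta>"
    using eventually_happens'[OF trivial_limit_at_right_real] by blast
  show ?thesis
  proof (rule that[of "q t"])
    show "\<bar>coeff (q t) i - coeff p i\<bar> \<le> \<eta>" if "i < n" for i
      using bspec[OF near, of i] that by (simp add: q0 dist_real_def)
    note count = root_count_line_poly_const[where S = True] root_count_line_poly_const[where S = False]
    have "root_count (\<lambda>z. Re z > 0) (line_poly t a' xs) = a"
      "root_count (\<lambda>z. Re z > 0) (line_poly (- t) b' ys) = 0"
      "root_count (\<lambda>z. Re z > 0) (line_poly 0 c' zs) = 0"
      using t by (simp_all add: count len abc')
    then show "root_count (\<lambda>z. Re z > 0) (q t) = a" by (simp add: count_q)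
    have "root_count (\<lambda>z. Re z < 0) (line_poly t a' xs) = 0"
      "root_count (\<lambda>z. Re z < 0) (line_poly (- t) b' ys) = b"
      "root_count (\<lambda>z. Re z < 0) (line_poly 0 c' zs) = 0"
      using t by (simp_all add: count len abc')
    then show "root_count (\<lambda>z. Re z < 0) (q t) = b" by (simp add: count_q)
    have "root_count (\<lambda>z. Re z = 0) (line_poly t a' xs) = 0"
      "root_count (\<lambda>z. Re z = 0) (line_poly (- t) b' ys) = 0"
      "root_count (\<lambda>z. Re z = 0) (line_poly 0 c' zs) = c"
      using t by (simp_all add: count len abc')
    then show "root_count (\<lambda>z. Re z = 0) (q t) = c" by (simp add: count_q)
  qed (fact monic_q deg_q)+
qed

text \<open>
  Pick a polynomial of the required inertia near the characteristic polynomial of \<open>A\<close>; it is the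
  characteristic polynomial of a matrix in the class of the superpattern.
\<close>
theorem superpatterns_inertially_arbitrary:
  assumes A: "A \<in> carrier_mat n n" and ri: "refined_inertia A = (0, 0, c1, c2)" and c1: "c1 \<ge> 2"
    and jac: "allows_full_rank_jacobian A" and S: "superpattern S (sgn_mat A)"
  shows "inertially_arbitrary S"
  unfolding inertially_arbitrary_def
proof (intro allI impI)
  fix a b c assume "a + b + c = dim_row S"
  then have abc: "a + b + c = n" using S A by (simp add: superpattern_def sgn_mat_def)
  obtain ps where ps: "full_rank_choice A ps" using jac by (auto simp: allows_full_rank_jacobian_def)
  obtain \<eta> where \<eta>: "\<eta> > 0" and attain: "\<And>q. (\<And>i. i < n \<Longrightarrow> \<bar>q i - coeff (char_poly A) i\<bar> \<le> \<eta>) \<Longrightarrow>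
      \<exists>M\<in>qual_class S. \<forall>i<n. coeff (char_poly M) i = q i"
    using char_coeffs_locally_surjective_on_superpattern[OF A ps S] by blast
  have monic: "monic (char_poly A)" "degree (char_poly A) = n" using degree_monic_char_poly[OF A] by auto
  have counts: "root_count (\<lambda>z. Re z > 0) (char_poly A) = 0"
    "root_count (\<lambda>z. Re z < 0) (char_poly A) = 0" "root_count (\<lambda>z. z = 0) (char_poly A) \<ge> 2"
    using ri c1 by (auto simp: refined_inertia_def num_eigenvalues_eq_root_count[OF A])
  obtain q where q: "monic q" "degree q = n" "\<And>i. i < n \<Longrightarrow> \<bar>coeff q i - coeff (char_poly A) i\<bar> \<le> \<eta>"
    and inertia_q: "root_count (\<lambda>z. Re z > 0) q = a" "root_count (\<lambda>z. Re z < 0) q = b"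
      "root_count (\<lambda>z. Re z = 0) q = c"
    using nearby_polys_of_every_inertia[OF monic counts abc \<eta>] by blast
  obtain M where M: "M \<in> qual_class S" "\<And>i. i < n \<Longrightarrow> coeff (char_poly M) i = coeff q i"
    using attain[of "coeff q"] q(3) by blast
  have "M \<in> carrier_mat n n" using M(1) S A
    by (auto simp: qual_class_def superpattern_def sgn_mat_def)
  note degM = degree_monic_char_poly[OF this]
  have "char_poly M = q"
  proof (rule poly_eqI)
    fix i show "coeff (char_poly M) i = coeff q i"
      using M(2)[of i] degM q by (cases i n rule: linorder_cases) (auto simp: coeff_eq_0)
  qed
  then have "inertia M = (a, b, c)"
    using inertia_q by (simp add: inertia_def num_eigenvalues_eq_root_count[OF \<open>M \<in> carrier_mat n n\<close>])
  then show "\<exists>M\<in>qual_class S. inertia M = (a, b, c)" using M(1) by blast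
qed


section \<open>Bordered matrices\<close>

text \<open>The block matrix with \<open>X\<close> and the column \<open>e\<^sub>j\<close> on top of the row \<open>(w, 0)\<close>.\<close>
definition bordered :: "nat \<Rightarrow> real mat \<Rightarrow> nat \<Rightarrow> (nat \<Rightarrow> real) \<Rightarrow> real mat" where
  "bordered n X j w = mat (Suc n) (Suc n) (\<lambda>(r, s).
     if r < n then (if s < n then X $$ (r, s) else of_bool (r = j)) else (if s < n then w s else 0))"

text \<open>
  The matrix of the theorem, for arbitrary \<open>X\<close> in place of \<open>A\<close> and with an additional row \<open>w\<close> at the
  bottom. Both are kept as parameters because perturbations of the matrix have the same form.
\<close>
definition twisted_bordered :: "nat \<Rightarrow> real mat \<Rightarrow> real \<Rightarrow> nat \<Rightarrow> nat \<Rightarrow> (nat \<Rightarrow> real) \<Rightarrow> real mat" where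
  "twisted_bordered n X b j k w = mat (Suc n) (Suc n) (\<lambda>(r, s).
     if r < n then (if s < n then X $$ (r, s) - of_bool (r = j \<and> s = k) * b else of_bool (r = j))
     else (if s < n then b * X $$ (k, s) + w s else 0))"

lemma bordered_carrier [simp]: "bordered n X j w \<in> carrier_mat (Suc n) (Suc n)"
  by (simp add: bordered_def)

lemma bordered_mat_eq_twisted:
  assumes A: "A \<in> carrier_mat n n" and "j < n" "k < n" "j \<noteq> k"
  shows "bordered_mat n A b j k = twisted_bordered n A b j k (\<lambda>_. 0)"
  using assms
  by (intro eq_matI)
     (auto simp: bordered_mat_def twisted_bordered_def Let_def P_mat_def mat_of_cols_def mat_of_rows_def
        less_Suc_eq)

text \<open>
  The similarity adds \<open>b\<close> times the last column, that is \<open>b * e\<^sub>j\<close>, to column \<open>k\<close>, which restores the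
  entry \<open>(j, k)\<close> of \<open>X\<close>, and subtracts \<open>b\<close> times row \<open>k\<close> from the last row, which leaves \<open>w\<close>. As
  \<open>j \<noteq> k\<close>, row \<open>k\<close> is neither changed by the twist nor does it meet the border.
\<close>
lemma char_poly_twisted_bordered:
  assumes "j < n" "k < n" "j \<noteq> k"
  shows "char_poly (twisted_bordered n X b j k w) = char_poly (bordered n X j w)"
proof -
  let ?M = "twisted_bordered n X b j k w"
  have M: "?M \<in> carrier_mat (Suc n) (Suc n)" by (simp add: twisted_bordered_def)
  have "add_col_sub_row b n k ?M = bordered n X j w"
  proof (intro eq_matI)
    fix r s assume "r < dim_row (bordered n X j w)" "s < dim_col (bordered n X j w)"
    then have rs: "r < Suc n" "s < Suc n" by (auto simp: bordered_def)
    show "add_col_sub_row b n k ?M $$ (r, s) = bordered n X j w $$ (r, s)"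
      using rs assms M by (subst add_col_sub_index_row) (auto simp: twisted_bordered_def bordered_def)
  qed (auto simp: twisted_bordered_def bordered_def)
  moreover have "similar_mat (add_col_sub_row b n k ?M) ?M"
    using assms by (intro add_col_sub_row_similar[OF M]) auto
  ultimately show ?thesis by (metis char_poly_similar)
qed

lemma char_poly_bordered_zero:
  assumes X: "X \<in> carrier_mat n n"
  shows "char_poly (bordered n X j (\<lambda>_. 0)) = [:0, 1:] * char_poly X"
proof -
  let ?C = "char_poly_matrix (bordered n X j (\<lambda>_. 0))"
  have C: "?C \<in> carrier_mat (Suc n) (Suc n)" by (simp add: bordered_def)
  have entry: "?C $$ (r, s) = (if r = s then [:0, 1:] else 0) + [:- bordered n X j (\<lambda>_. 0) $$ (r, s):]"
    if "r < Suc n" "s < Suc n" for r s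
    using that by (simp add: char_poly_matrix_def bordered_def)
  have last_row: "?C $$ (n, s) = (if s = n then [:0, 1:] else 0)" if "s < Suc n" for s
    unfolding entry[OF lessI that] using that by (auto simp: bordered_def)
  have "det ?C = (\<Sum>s<Suc n. ?C $$ (n, s) * cofactor ?C n s)"
    by (rule laplace_expansion_row[OF C]) simp
  also have "\<dots> = (\<Sum>s<Suc n. if s = n then [:0, 1:] * cofactor ?C n n else 0)"
    by (intro sum.cong) (simp_all add: last_row)
  also have "\<dots> = [:0, 1:] * cofactor ?C n n" by simp
  also have "cofactor ?C n n = det (mat_delete ?C n n)" by (simp add: cofactor_def)
  also have "mat_delete ?C n n = char_poly_matrix X"
    using X C by (intro eq_matI) (auto simp: mat_delete_def bordered_def char_poly_matrix_def)
  finally show ?thesis by (simp add: char_poly_def)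
qed

lemma det_bordered_unit:
  assumes A: "A \<in> carrier_mat n n" and j: "j < n" and v: "v < n"
  shows "det (bordered n A j (\<lambda>s. of_bool (s = v) * t)) =
     t * ((-1) ^ (n + v) * (-1) ^ (j + (n - 1)) * det (mat_delete A j v))"
proof -
  let ?M = "bordered n A j (\<lambda>s. of_bool (s = v) * t)"
  let ?D = "mat_delete ?M n v"
  have M: "?M \<in> carrier_mat (Suc n) (Suc n)" by (simp add: bordered_def)
  have D: "?D \<in> carrier_mat n n" using mat_delete_carrier[OF M, of n v] by simp
  have last: "?D $$ (r, n - 1) = of_bool (r = j)" if "r < n" for r
    using that v by (auto simp: mat_delete_def bordered_def)
  have "det ?M = (\<Sum>s<Suc n. ?M $$ (n, s) * cofactor ?M n s)"
    by (rule laplace_expansion_row[OF M]) simp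
  also have "\<dots> = (\<Sum>s<Suc n. if s = v then t * cofactor ?M n v else 0)"
    using v by (intro sum.cong) (auto simp: bordered_def)
  also have "\<dots> = t * ((-1) ^ (n + v) * det ?D)" using v by (simp add: cofactor_def)
  also have "det ?D = (\<Sum>r<n. ?D $$ (r, n - 1) * cofactor ?D r (n - 1))"
    by (rule laplace_expansion_column[OF D]) (use j in simp)
  also have "\<dots> = (\<Sum>r<n. if r = j then cofactor ?D j (n - 1) else 0)"
    using last by (intro sum.cong) auto
  also have "\<dots> = (-1) ^ (j + (n - 1)) * det (mat_delete ?D j (n - 1))"
    using j by (simp add: cofactor_def)
  also have "mat_delete ?D j (n - 1) = mat_delete A j v"
    using A v j by (intro eq_matI) (auto simp: mat_delete_def bordered_def)
  finally show ?thesis by (simp add: mult.assoc)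
qed

lemma coeff_0_char_poly:
  assumes M: "(M :: real mat) \<in> carrier_mat m m"
  shows "coeff (char_poly M) 0 = (- 1) ^ m * det M"
proof -
  have "poly (char_poly M) 0 = det ((- 1) \<cdot>\<^sub>m M)"
    unfolding char_poly_def
    by (rule poly_det_cong[of _ m]) (use M in \<open>auto simp: char_poly_matrix_def\<close>)
  then show ?thesis using M by (simp add: poly_0_coeff_0)
qed

text \<open>
  All nonzero entries of \<open>B\<close> are taken as variables. A direction \<open>E\<close> for \<open>A\<close> lifts to the direction with
  \<open>E\<close> in the upper left block and \<open>b\<close> times row \<open>k\<close> of \<open>E\<close> in the last row; the perturbed matrix is again a
  bordered one, so the lift moves the coefficients as \<open>z\<close> times the effect of \<open>E\<close>. The position
  \<open>(n, v)\<close> moves the constant coefficient. The lift uses only nonzero entries of \<open>B\<close>: the entry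
  \<open>(j, k)\<close> of \<open>A\<close>, the only one that the twist can turn into zero, is avoided by the choice.
\<close>
theorem bordered_full_rank_jacobian:
  assumes A: "A \<in> carrier_mat n n" and ps: "full_rank_choice A ps" and jk_ps: "(j, k) \<notin> set ps"
    and j: "j < n" and k: "k < n" and jk: "j \<noteq> k" and b: "b \<noteq> 0"
    and v: "v < n" "A $$ (k, v) \<noteq> 0" "det (mat_delete A j v) \<noteq> 0"
  shows "allows_full_rank_jacobian (bordered_mat n A b j k)"
proof -
  define B where "B = bordered_mat n A b j k"
  have B_eq: "B = twisted_bordered n A b j k (\<lambda>_. 0)"
    unfolding B_def by (rule bordered_mat_eq_twisted[OF A j k jk])
  have B: "B \<in> carrier_mat (Suc n) (Suc n)" by (simp add: B_eq twisted_bordered_def)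
  define \<alpha> \<beta> where "\<alpha> = (\<lambda>p. A $$ p)" and "\<beta> = (\<lambda>p. B $$ p)"
  let ?dA = "\<lambda>i E. \<Sum>p\<in>positions n. char_partial n \<alpha> i p * E p"
  let ?dB = "\<lambda>i E. \<Sum>p\<in>positions (Suc n). char_partial (Suc n) \<beta> i p * E p"
  have ps_pos: "\<And>p. p \<in> set ps \<Longrightarrow> p \<in> positions n \<and> A $$ p \<noteq> 0"
    and surj: "surjective_along n \<alpha> (set ps)"
    using ps full_rank_choice_iff_surjective_along[OF A] unfolding \<alpha>_def by blast+
  define lift where "lift E = (\<lambda>(r, s). if s < n then (if r < n then E (r, s) else if r = n then b * E (k, s) else 0) else 0)"
    for E :: "nat \<times> nat \<Rightarrow> real"
  define unit where "unit = (\<lambda>p :: nat \<times> nat. of_bool (p = (n, v)) :: real)"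
  have dB_lift: "?dB 0 (lift E) = 0" "?dB (Suc i) (lift E) = ?dA i E" for i E
  proof -
    let ?X = "\<lambda>t. mat n n (\<lambda>p. \<alpha> p + t * E p)"
    have "mat (Suc n) (Suc n) (\<lambda>p. \<beta> p + t * lift E p) = twisted_bordered n (?X t) b j k (\<lambda>_. 0)" for t
      using k by (intro eq_matI) (auto simp: \<alpha>_def \<beta>_def B_eq twisted_bordered_def lift_def algebra_simps)
    then have char: "char_poly (mat (Suc n) (Suc n) (\<lambda>p. \<beta> p + t * lift E p)) = [:0, 1:] * char_poly (?X t)" for t
      by (simp only: char_poly_twisted_bordered[OF j k jk] char_poly_bordered_zero[OF mat_carrier])
    have "((\<lambda>t. 0) has_field_derivative ?dB 0 (lift E)) (at 0)"
      using DERIV_char_coeff_line[of "Suc n" 0 \<beta> "lift E"] by (simp add: char_coeff_def char)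
    then show "?dB 0 (lift E) = 0" using DERIV_unique DERIV_const by blast
    have "((\<lambda>t. char_coeff n i (\<lambda>p. \<alpha> p + t * E p)) has_field_derivative ?dB (Suc i) (lift E)) (at 0)"
      using DERIV_char_coeff_line[of "Suc n" "Suc i" \<beta> "lift E"] by (simp add: char_coeff_def char)
    then show "?dB (Suc i) (lift E) = ?dA i E" using DERIV_char_coeff_line by (rule DERIV_unique)
  qed
  define \<delta> where "\<delta> = (- 1) ^ Suc n * ((-1) ^ (n + v) * (-1) ^ (j + (n - 1)) * det (mat_delete A j v))"
  have \<delta>: "\<delta> \<noteq> 0" using v(3) by (simp add: \<delta>_def)
  have dB_unit: "?dB 0 unit = \<delta>"
  proof -
    have "mat (Suc n) (Suc n) (\<lambda>p. \<beta> p + t * unit p) =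
        twisted_bordered n A b j k (\<lambda>s. of_bool (s = v) * t)" for t
      using v(1) by (intro eq_matI) (auto simp: \<beta>_def B_eq twisted_bordered_def unit_def)
    then have "char_coeff (Suc n) 0 (\<lambda>p. \<beta> p + t * unit p) = \<delta> * t" for t
      using coeff_0_char_poly[of "bordered n A j (\<lambda>s. of_bool (s = v) * t)" "Suc n"]
      by (simp add: char_coeff_def char_poly_twisted_bordered[OF j k jk] det_bordered_unit[OF A j v(1)]
          \<delta>_def)
    then have "((\<lambda>t. \<delta> * t) has_field_derivative ?dB 0 unit) (at 0)"
      using DERIV_char_coeff_line[of "Suc n" 0 \<beta> unit] by simp
    moreover have "((\<lambda>t. \<delta> * t) has_field_derivative \<delta>) (at 0)" by (auto intro!: derivative_eq_intros)
    ultimately show ?thesis by (rule DERIV_unique)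
  qed
  define P where "P = {p \<in> positions (Suc n). \<beta> p \<noteq> 0}"
  obtain ps' where ps': "set ps' = P" "distinct ps'"
    using finite_distinct_list[of P] by (auto simp: P_def)
  have lift_supp: "lift E p = 0" if E: "\<And>p. p \<notin> set ps \<Longrightarrow> E p = 0" and p: "p \<notin> P" for E p
  proof (rule ccontr)
    assume nz: "lift E p \<noteq> 0"
    obtain r s where rs: "p = (r, s)" by (cases p)
    from nz have s: "s < n" and cases: "r < n \<and> E (r, s) \<noteq> 0 \<or> r = n \<and> E (k, s) \<noteq> 0"
      by (auto simp: rs lift_def split: if_splits)
    from cases have "B $$ (r, s) \<noteq> 0"
    proof
      assume *: "r < n \<and> E (r, s) \<noteq> 0"
      then have "(r, s) \<in> set ps" using E by blast
      then show ?thesis using ps_pos jk_ps * s by (auto simp: B_eq twisted_bordered_def)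
    next
      assume *: "r = n \<and> E (k, s) \<noteq> 0"
      then have "(k, s) \<in> set ps" using E by blast
      then show ?thesis using ps_pos b * s by (auto simp: B_eq twisted_bordered_def)
    qed
    moreover have "p \<in> positions (Suc n)" using cases s by (auto simp: rs)
    ultimately show False using p by (simp add: P_def \<beta>_def rs)
  qed
  have unit_supp: "unit p = 0" if "p \<notin> P" for p
  proof -
    have "(n, v) \<in> P" using v b by (auto simp: P_def \<beta>_def B_eq twisted_bordered_def)
    then show ?thesis using that by (auto simp: unit_def)
  qed
  have "surjective_along (Suc n) \<beta> P"
    unfolding surjective_along_def
  proof
    fix u :: "nat \<Rightarrow> real"
    \<comment> \<open>First match the constant coefficient with the entry \<open>(n, v)\<close>, then correct the others by a lift.\<close>
    define \<tau> where "\<tau> = u 0 / \<delta>"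
    obtain E where E: "\<And>p. p \<notin> set ps \<Longrightarrow> E p = 0"
      "\<And>i. i < n \<Longrightarrow> ?dA i E = u (Suc i) - \<tau> * ?dB (Suc i) unit"
      using spec[OF surj[unfolded surjective_along_def], of "\<lambda>i. u (Suc i) - \<tau> * ?dB (Suc i) unit"]
      by auto
    let ?E = "\<lambda>p. lift E p + \<tau> * unit p"
    have dB: "?dB i ?E = ?dB i (lift E) + \<tau> * ?dB i unit" for i
      by (simp add: distrib_left sum.distrib sum_distrib_left ac_simps)
    have "?dB i ?E = u i" if "i < Suc n" for i
    proof (cases i)
      case 0
      have "?dB 0 ?E = 0 + \<tau> * \<delta>" unfolding dB dB_lift dB_unit ..
      then show ?thesis using \<delta> by (simp only: 0 \<tau>_def) simp
    next
      case (Suc i')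
      have "?dB (Suc i') ?E = ?dA i' E + \<tau> * ?dB (Suc i') unit" unfolding dB dB_lift ..
      also have "?dA i' E = u (Suc i') - \<tau> * ?dB (Suc i') unit" using that Suc by (intro E(2)) simp
      finally show ?thesis by (simp only: Suc diff_add_cancel)
    qed
    moreover have "?E p = 0" if "p \<notin> P" for p
      using lift_supp[OF E(1) that] unit_supp[OF that] by simp
    ultimately show "\<exists>E. (\<forall>p. p \<notin> P \<longrightarrow> E p = 0) \<and> (\<forall>i<Suc n. ?dB i E = u i)"
      by (intro exI[of _ ?E]) blast
  qed
  then have "full_rank_choice B ps'"
    unfolding full_rank_choice_iff_surjective_along[OF B] ps'(1)
    using ps'(2) by (auto simp: P_def \<beta>_def)
  then show ?thesis unfolding allows_full_rank_jacobian_def B_def by blast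
qed

theorem theorem5p5:
  fixes n j k v c1 c2 :: nat and P :: "sign mat" and A B :: "real mat" and b :: real
  assumes "P \<in> carrier_mat n n"
    and "A \<in> qual_class P"
    and "refined_inertia A = (0, 0, c1, c2)"
    and "c1 \<ge> 2"
    and "allows_full_rank_jacobian A"
    and "j < n" and "k < n" and "j \<noteq> k"
    and "non_jacobian_for_some_choice A j k"
    and "b \<noteq> 0"
    and "v < n" and "A $$ (k, v) \<noteq> 0" and "det (mat_delete A j v) \<noteq> 0"
    and "B = bordered_mat n A b j k"
  shows "refined_inertia B = (0, 0, c1 + 1, c2)
    \<and> allows_full_rank_jacobian B
    \<and> (\<forall>S. superpattern S (sgn_mat B) \<longrightarrow> inertially_arbitrary S)"
proof -
  have A: "A \<in> carrier_mat n n" using assms(1,2) by (auto simp: qual_class_def)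
  have B_eq: "B = twisted_bordered n A b j k (\<lambda>_. 0)"
    unfolding assms(14) by (rule bordered_mat_eq_twisted[OF A assms(6-8)])
  have B: "B \<in> carrier_mat (Suc n) (Suc n)" by (simp add: B_eq twisted_bordered_def)
  have char: "char_poly B = [:- 0, 1:] * char_poly A"
    unfolding B_eq char_poly_twisted_bordered[OF assms(6-8)] char_poly_bordered_zero[OF A] by simp
  have "char_poly A \<noteq> 0" using degree_monic_char_poly[OF A] by auto
  then have "root_count R (char_poly B) = root_count R [:- 0, 1:] + root_count R (char_poly A)" for R
    unfolding char by (intro root_count_mult) simp_all
  then have count: "num_eigenvalues B R = of_bool (R 0) + num_eigenvalues A R" for R
    by (simp add: num_eigenvalues_eq_root_count[OF A] num_eigenvalues_eq_root_count[OF B] root_count_linear[of R 0, simplified])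
  have ri: "refined_inertia B = (0, 0, c1 + 1, c2)"
    using assms(3) by (simp add: refined_inertia_def count)
  obtain ps where "full_rank_choice A ps" "(j, k) \<notin> set ps"
    using assms(9) by (auto simp: non_jacobian_for_some_choice_def)
  then have jac: "allows_full_rank_jacobian B"
    unfolding assms(14) by (rule bordered_full_rank_jacobian[OF A]) fact+
  have "inertially_arbitrary S" if "superpattern S (sgn_mat B)" for S
    using assms(4) by (intro superpatterns_inertially_arbitrary[OF B ri _ jac that]) simp
  with ri jac show ?thesis by blast
qed

end
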